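(* Let $k$ be an odd integer with $k\ge 5$, and let $D$ be a strong $k$-quasi-transitive digraph with $\mathrm{diam}(D)\ge k+2$. Let $u,v\in V(D)$ satisfy $d(u,v)=k+2$, and let $P$ be a shortest $(u,v)$-path in $D$. Then $D[V(P)]$ is either a semicomplete digraph or a semicomplete bipartite digraph, and $D[V(D)\setminus V(P)]$ is either a semicomplete digraph, a semicomplete bipartite digraph, or an empty digraph.
   Context: All digraphs are finite, without loops or multiple arcs (a pair of opposite arcs is allowed). Two vertices $x,y$ are adjacent if $xy\in A(D)$ or $yx\in A(D)$. For an integer $k\ge 2$, a digraph $D$ is $k$-quasi-transitive if for every path $x_0x_1\ldots x_k$ of length $k$ in $D$, the vertices $x_0$ and $x_k$ are adjacent. $d(x,y)$ is the length of a shortest $(x,y)$-path ($\infty$ if none), and $\mathrm{diam}(D)=\max_{x,y\in V(D)} d(x,y)$. $D[S]$ denotes the subdigraph induced by $S$. A semicomplete digraph is one in which every two distinct vertices are adjacent. A semicomplete bipartite digraph is a digraph whose vertex set has a bipartition $(X,Y)$ with no arcs inside $X$ or inside $Y$ and with every vertex of $X$ adjacent to every vertex of $Y$. An empty digraph is one with no arcs. *)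

theory Defs
  imports Main "HOL-Library.Extended_Nat"
begin

definition digraph :: "'a set \<Rightarrow> ('a \<times> 'a) set \<Rightarrow> bool" where
  "digraph V A \<longleftrightarrow> finite V \<and> A \<subseteq> V \<times> V \<and> (\<forall>x. (x, x) \<notin> A)"

definition adjacent :: "('a \<times> 'a) set \<Rightarrow> 'a \<Rightarrow> 'a \<Rightarrow> bool" where
  "adjacent A x y \<longleftrightarrow> (x, y) \<in> A \<or> (y, x) \<in> A"

text \<open>A path is a nonempty list of pairwise distinct vertices, consecutive ones joined
  by arcs; its length is the number of arcs (length of the list minus one).\<close>

definition is_path :: "'a set \<Rightarrow> ('a \<times> 'a) set \<Rightarrow> 'a list \<Rightarrow> bool" where
  "is_path V A p \<longleftrightarrow> p \<noteq> [] \<and> distinct p \<and> set p \<subseteq> V \<and>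
     (\<forall>i. Suc i < length p \<longrightarrow> (p ! i, p ! Suc i) \<in> A)"

definition is_xy_path :: "'a set \<Rightarrow> ('a \<times> 'a) set \<Rightarrow> 'a \<Rightarrow> 'a \<Rightarrow> 'a list \<Rightarrow> bool" where
  "is_xy_path V A x y p \<longleftrightarrow> is_path V A p \<and> hd p = x \<and> last p = y"

definition k_quasi_transitive :: "nat \<Rightarrow> 'a set \<Rightarrow> ('a \<times> 'a) set \<Rightarrow> bool" where
  "k_quasi_transitive k V A \<longleftrightarrow>
     (\<forall>p. is_path V A p \<and> length p = k + 1 \<longrightarrow> adjacent A (hd p) (last p))"

definition strong :: "'a set \<Rightarrow> ('a \<times> 'a) set \<Rightarrow> bool" where
  "strong V A \<longleftrightarrow> (\<forall>x\<in>V. \<forall>y\<in>V. \<exists>p. is_xy_path V A x y p)"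

text \<open>Distance: length of a shortest (x,y)-path, \<infinity> if none.\<close>

definition dist :: "'a set \<Rightarrow> ('a \<times> 'a) set \<Rightarrow> 'a \<Rightarrow> 'a \<Rightarrow> enat" where
  "dist V A x y = (INF p \<in> {p. is_xy_path V A x y p}. enat (length p - 1))"

definition diam :: "'a set \<Rightarrow> ('a \<times> 'a) set \<Rightarrow> enat" where
  "diam V A = (SUP xy \<in> V \<times> V. dist V A (fst xy) (snd xy))"

definition shortest_path :: "'a set \<Rightarrow> ('a \<times> 'a) set \<Rightarrow> 'a \<Rightarrow> 'a \<Rightarrow> 'a list \<Rightarrow> bool" where
  "shortest_path V A x y p \<longleftrightarrow> is_xy_path V A x y p \<and> enat (length p - 1) = dist V A x y"

definition induced_arcs :: "('a \<times> 'a) set \<Rightarrow> 'a set \<Rightarrow> ('a \<times> 'a) set" where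
  "induced_arcs A S = A \<inter> (S \<times> S)"

definition semicomplete :: "'a set \<Rightarrow> ('a \<times> 'a) set \<Rightarrow> bool" where
  "semicomplete V A \<longleftrightarrow> (\<forall>x\<in>V. \<forall>y\<in>V. x \<noteq> y \<longrightarrow> adjacent A x y)"

definition semicomplete_bipartite :: "'a set \<Rightarrow> ('a \<times> 'a) set \<Rightarrow> bool" where
  "semicomplete_bipartite V A \<longleftrightarrow>
     (\<exists>X Y. X \<noteq> {} \<and> Y \<noteq> {} \<and> X \<inter> Y = {} \<and> X \<union> Y = V \<and>
        (\<forall>x\<in>X. \<forall>x'\<in>X. (x, x') \<notin> A) \<and> (\<forall>y\<in>Y. \<forall>y'\<in>Y. (y, y') \<notin> A) \<and>
        (\<forall>x\<in>X. \<forall>y\<in>Y. adjacent A x y))"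

definition empty_digraph :: "'a set \<Rightarrow> ('a \<times> 'a) set \<Rightarrow> bool" where
  "empty_digraph V A \<longleftrightarrow> A = {}"

end

theory Submission
  imports Defs
begin

text \<open>
  Let \<open>P = x\<^sub>0 \<dots> x\<^bsub>k+2\<^esub>\<close>. Being a shortest path, \<open>P\<close> has no forward arc between
  non-consecutive vertices, so a path inside \<open>P\<close> that is not a segment is a sequence of segments
  running backwards, joined by backward arcs. Choosing such paths with \<open>k + 1\<close> vertices forces all
  backward arcs between vertices of opposite parity; a single further backward arc forces all of them.
  Hence for \<open>d = 2\<close> (bipartite case) or \<open>d = 1\<close> (semicomplete case) the backward arcs
  \<open>x\<^sub>i x\<^sub>j\<close> with \<open>j + 2 \<le> i\<close> are exactly those with \<open>i + j + 1\<close> divisible by \<open>d\<close>.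

  For a vertex \<open>w\<close> outside \<open>P\<close>, paths that traverse \<open>k\<close> vertices of \<open>P\<close> show that \<open>w\<close> is
  adjacent to \<open>P\<close>, and that its neighbours in \<open>P\<close> have indices in one class modulo \<open>d\<close>. An arc outside
  \<open>P\<close> joins vertices of opposite classes, and conversely two vertices of opposite classes are adjacent,
  because a path \<open>w \<rightarrow> x\<^sub>i \<rightarrow> \<dots> \<rightarrow> x\<^sub>j \<rightarrow> w'\<close> of length \<open>k\<close> exists. The delicate cases
  are two vertices that both only receive (or only send) arcs from (to) \<open>P\<close>, which need an induction
  on the distance to (from) \<open>P\<close>, and two vertices having arcs of both kinds, where the constraint
  \<open>i \<le> j + 2\<close> for \<open>x\<^sub>j \<rightarrow> w \<rightarrow> x\<^sub>i\<close> leaves finitely many positions to exclude.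
  Reversing all arcs and the order of \<open>P\<close> yields the dual statements.
\<close>

lemma adjacent_commute: "adjacent A a b \<longleftrightarrow> adjacent A b a"
  by (auto simp: adjacent_def)

lemma adjacent_converse: "adjacent (A\<inverse>) a b \<longleftrightarrow> adjacent A a b"
  by (auto simp: adjacent_def)

lemma relpow_converse: "(A\<inverse>) ^^ n = (A ^^ n)\<inverse>" for A :: "('a \<times> 'a) set"
proof (induction n)
  case (Suc n)
  have "(A\<inverse>) ^^ Suc n = (A ^^ n)\<inverse> O A\<inverse>" using Suc by simp
  also have "\<dots> = (A O A ^^ n)\<inverse>" by (rule converse_relcomp[symmetric])
  also have "A O A ^^ n = A ^^ Suc n" using relpow_commute[of A n] by simp
  finally show ?case .
qed auto

section \<open>A shortest path as an indexed sequence, and paths inside it\<close>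

abbreviation arcwise :: "('a \<times> 'a) set \<Rightarrow> 'a list \<Rightarrow> bool" where
  "arcwise A \<equiv> successively (\<lambda>a b. (a, b) \<in> A)"

text \<open>The assumption \<open>geodesic\<close> bounds walks (\<open>A ^^ l\<close>) rather than
  paths, so any composed arcs, also through vertices outside \<open>P\<close>, give an index
  inequality without a check of distinctness.\<close>

locale kqt_geodesic =
  fixes A :: "('a \<times> 'a) set" and k :: nat and x :: "nat \<Rightarrow> 'a"
  assumes kqt: "\<And>p. distinct p \<Longrightarrow> arcwise A p \<Longrightarrow> length p = k + 1 \<Longrightarrow> adjacent A (hd p) (last p)"
    and k_odd: "odd k" and k_ge: "k \<ge> 5"
    and inj_x: "inj_on x {..k+2}"
    and step: "\<And>i. i < k + 2 \<Longrightarrow> (x i, x (Suc i)) \<in> A"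
    and geodesic: "\<And>i j l. i \<le> k + 2 \<Longrightarrow> j \<le> k + 2 \<Longrightarrow> (x i, x j) \<in> A ^^ l \<Longrightarrow> j \<le> i + l"
begin

abbreviation E :: "nat \<Rightarrow> nat \<Rightarrow> bool" where
  "E i j \<equiv> (x i, x j) \<in> A"

abbreviation S :: "'a set" where
  "S \<equiv> x ` {..k+2}"

text \<open>Paths inside \<open>P\<close> are kept as lists of indices, so that disjointness of
  segments becomes interval arithmetic.\<close>

definition ipath :: "nat list \<Rightarrow> bool" where
  "ipath q \<longleftrightarrow> q \<noteq> [] \<and> distinct q \<and> set q \<subseteq> {..k+2} \<and> successively E q"

text \<open>The parameter \<open>m\<close> counts vertices, not arcs; length \<open>k\<close>
  corresponds to \<open>m = k + 1\<close>, that is, to omitting two of the \<open>k + 3\<close>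
  indices.\<close>

definition linked :: "nat \<Rightarrow> nat \<Rightarrow> nat \<Rightarrow> bool" where
  "linked i j m \<longleftrightarrow> (\<exists>q. ipath q \<and> hd q = i \<and> last q = j \<and> length q = m)"

lemma x_eq_iff: "i \<le> k + 2 \<Longrightarrow> j \<le> k + 2 \<Longrightarrow> x i = x j \<longleftrightarrow> i = j"
  using inj_x by (auto simp: inj_on_def)

lemma geodesic1: "i \<le> k + 2 \<Longrightarrow> j \<le> k + 2 \<Longrightarrow> E i j \<Longrightarrow> j \<le> i + 1"
  using geodesic[of i j 1] by simp

lemma geodesic2:
  assumes "i \<le> k + 2" "j \<le> k + 2" "(x i, w) \<in> A" "(w, x j) \<in> A"
  shows "j \<le> i + 2"
proof -
  have "(x i, x j) \<in> A ^^ Suc (Suc 0)" using assms(3,4) by auto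
  from geodesic[OF assms(1,2) this] show ?thesis by simp
qed

lemma geodesic3:
  assumes "i \<le> k + 2" "j \<le> k + 2" "(x i, w) \<in> A" "(w, w') \<in> A" "(w', x j) \<in> A"
  shows "j \<le> i + 3"
proof -
  have "(x i, x j) \<in> A ^^ Suc (Suc (Suc 0))" using assms(3-5) by auto
  from geodesic[OF assms(1,2) this] show ?thesis by simp
qed

definition ivl :: "nat \<Rightarrow> nat \<Rightarrow> nat list" where
  "ivl i j = [i..<Suc j]"

lemma ivl_simps:
  assumes "i \<le> j"
  shows "hd (ivl i j) = i" "last (ivl i j) = j" "set (ivl i j) = {i..j}"
    "length (ivl i j) = Suc j - i" "ivl i j \<noteq> []"
  using assms by (auto simp: ivl_def hd_append)

lemma ipath_ivl:
  assumes "i \<le> j" "j \<le> k + 2"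
  shows "ipath (ivl i j)"
proof -
  have "successively E (ivl i j)"
    using assms step by (auto simp: ivl_def successively_conv_nth simp del: upt_Suc)
  then show ?thesis using assms by (auto simp: ipath_def ivl_def)
qed

lemma ipath_append:
  assumes "ipath p" "ipath q" "set p \<inter> set q = {}" "E (last p) (hd q)"
  shows "ipath (p @ q)"
  using assms by (auto simp: ipath_def successively_append_iff)

lemma arcwise_map: "ipath q \<Longrightarrow> arcwise A (map x q)"
  by (simp add: ipath_def successively_map)

lemma distinct_map_x: "ipath q \<Longrightarrow> distinct (map x q)"
  using inj_on_subset[OF inj_x, of "set q"] by (simp add: ipath_def distinct_map)

lemma ipath_bounds: "ipath q \<Longrightarrow> hd q \<le> k + 2 \<and> last q \<le> k + 2"
  unfolding ipath_def by (meson atMost_iff hd_in_set last_in_set subsetD)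

lemma linked_bounds: "linked i j m \<Longrightarrow> i \<le> k + 2 \<and> j \<le> k + 2"
  unfolding linked_def using ipath_bounds by blast

lemma linkedI: "ipath q \<Longrightarrow> hd q = i \<Longrightarrow> last q = j \<Longrightarrow> length q = m \<Longrightarrow> linked i j m"
  unfolding linked_def by blast

lemma linked_ivl:
  assumes "i \<le> j" "j \<le> k + 2" "l + i = j + 1"
  shows "linked i j l"
  by (rule linkedI[of "ivl i j"]) (use assms ipath_ivl in \<open>simp_all add: ivl_simps\<close>)

text \<open>Follow \<open>P\<close> from \<open>i\<close> to \<open>m\<close>, jump back to
  \<open>b\<close>, follow \<open>P\<close> to \<open>j\<close>. The second segment lies wholly
  below the first because \<open>j < i\<close>. The last equation is the vertex count without
  subtraction; \<open>linked_3\<close> and \<open>linked_4\<close> add further jumps.\<close>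

lemma linked_2:
  assumes "i \<le> m" "m \<le> k + 2" "b \<le> j" "j < i" "E m b" "l + i + b = m + j + 2"
  shows "linked i j l"
proof (rule linkedI)
  show "ipath (ivl i m @ ivl b j)"
    by (intro ipath_append ipath_ivl) (use assms in \<open>auto simp: ivl_simps\<close>)
qed (use assms in \<open>simp_all add: ivl_simps\<close>)

lemma linked_3:
  assumes "i \<le> m" "m \<le> k + 2" "b \<le> c" "c < i" "e \<le> j" "j < b" "E m b" "E c e"
    "l + i + b + e = m + c + j + 3"
  shows "linked i j l"
proof (rule linkedI)
  show "ipath (ivl i m @ ivl b c @ ivl e j)"
    by (intro ipath_append ipath_ivl) (use assms in \<open>auto simp: ivl_simps\<close>)
qed (use assms in \<open>simp_all add: ivl_simps\<close>)

lemma linked_4: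
  assumes "i \<le> m" "m \<le> k + 2" "b \<le> c" "c < i" "e \<le> f" "f < b" "g \<le> j" "j < e"
    "E m b" "E c e" "E f g" "l + i + b + e + g = m + c + f + j + 4"
  shows "linked i j l"
proof (rule linkedI)
  show "ipath (ivl i m @ ivl b c @ ivl e f @ ivl g j)"
    by (intro ipath_append ipath_ivl) (use assms in \<open>auto simp: ivl_simps\<close>)
qed (use assms in \<open>simp_all add: ivl_simps\<close>)

lemma linked_adjacent:
  assumes "linked i j (k + 1)"
  shows "adjacent A (x i) (x j)"
proof -
  from assms obtain q where q: "ipath q" "hd q = i" "last q = j" "length q = k + 1"
    unfolding linked_def by blast
  have "adjacent A (hd (map x q)) (last (map x q))"
    by (rule kqt) (use q distinct_map_x arcwise_map in auto)
  moreover have "q \<noteq> []" using q by (auto simp: ipath_def)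
  ultimately show ?thesis using q by (simp add: hd_map last_map)
qed

text \<open>The other orientation would be a forward arc skipping a vertex of the geodesic.\<close>

lemma adjacent_back:
  assumes "adjacent A (x i) (x j)" "j + 2 \<le> i" "i \<le> k + 2"
  shows "E i j"
  using assms geodesic1[of j i] by (auto simp: adjacent_def)

lemma linked_back: "linked i j (k + 1) \<Longrightarrow> j + 2 \<le> i \<Longrightarrow> E i j"
  using linked_adjacent adjacent_back linked_bounds by blast

lemma linked_back': "linked j i (k + 1) \<Longrightarrow> j + 2 \<le> i \<Longrightarrow> E i j"
  by (rule adjacent_back[OF adjacent_commute[THEN iffD1, OF linked_adjacent]])
     (use linked_bounds in auto)

section \<open>Backward arcs of the geodesic\<close>

lemma back_k: "i \<le> 2 \<Longrightarrow> E (i + k) i"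
  by (rule linked_back', rule linked_ivl) (use k_ge in auto)

text \<open>The path is \<open>k+2\<close>, then \<open>2..k\<close>, then \<open>0\<close>,
  omitting \<open>1\<close> and \<open>k+1\<close>; its jumps are the arcs between the ends of
  segments of length \<open>k\<close>.\<close>

lemma back_last_first: "E (k + 2) 0"
  by (rule linked_back, rule linked_3[where m = "k+2" and b = 2 and c = k and e = 0])
     (use k_ge back_k[of 0] back_k[of 2] in \<open>auto simp: add.commute\<close>)

text \<open>With \<open>k+2\<close> to \<open>0\<close> available, \<open>P\<close> closes to a
  cycle; going around it from \<open>i + 3\<close> to \<open>i\<close> omits exactly
  \<open>i + 1\<close> and \<open>i + 2\<close>.\<close>

lemma back_3: "i + 3 \<le> k + 2 \<Longrightarrow> E (i + 3) i"
  by (rule linked_back, rule linked_2[where m = "k+2" and b = 0])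
     (use k_ge back_last_first in auto)

text \<open>Each arc out of \<open>k+2\<close> yields the one ending two indices lower: the path
  \<open>k+2\<close>, \<open>b..k\<close>, \<open>0..b-2\<close> omits \<open>k+1\<close> and
  \<open>b-1\<close>. The arcs into \<open>0\<close> in \<open>back_first\<close> arise
  symmetrically.\<close>

lemma back_last: "2 * s + 3 \<le> k + 2 \<Longrightarrow> E (k + 2) (k + 2 - (2 * s + 3))"
proof (induction s)
  case 0
  then show ?case using back_3[of "k - 1"] k_ge by (simp add: numeral_eq_Suc)
next
  case (Suc s)
  have IH: "E (k + 2) (k + 2 - (2 * s + 3))" using Suc by auto
  show ?case
    by (rule linked_back,
        rule linked_3[where m = "k+2" and b = "k + 2 - (2 * s + 3)" and c = k and e = 0])
       (use k_ge IH Suc.prems back_k[of 0] in auto)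
qed

lemma back_first: "2 * s + 3 \<le> k + 2 \<Longrightarrow> E (2 * s + 3) 0"
proof (induction s)
  case 0
  then show ?case using back_3[of 0] by simp
next
  case (Suc s)
  have IH: "E (2 * s + 3) 0" using Suc by auto
  show ?case
    by (rule linked_back, rule linked_3[where m = "k+2" and b = 2 and c = "2 * s + 3" and e = 0])
       (use k_ge IH Suc.prems back_k[of 2] in \<open>auto simp: add.commute\<close>)
qed

lemma back_last_even: 
  assumes "even j" "j < k"
  shows "E (k + 2) j"
proof -
  have "\<exists>s. k + 2 = j + 2 * s + 3"
    using assms k_odd by presburger
  then obtain s where "k + 2 = j + 2 * s + 3" ..
  then show ?thesis using back_last[of s] by (simp add: numeral_eq_Suc)
qed

lemma back_first_odd:
  assumes "odd i" "3 \<le> i" "i \<le> k + 2"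
  shows "E i 0"
proof -
  have "\<exists>s. i = 2 * s + 3" using assms by presburger
  then obtain s where "i = 2 * s + 3" ..
  then show ?thesis using back_first[of s] assms by simp
qed

text \<open>Segments \<open>i..k+2\<close>, \<open>b..c\<close>, \<open>0..j\<close>, joined by a
  jump out of \<open>k+2\<close> and one into \<open>0\<close>. At this stage \<open>k+2\<close>
  reaches only even indices and only odd ones reach \<open>0\<close>, so the parity of
  \<open>j\<close> decides which two indices between \<open>j\<close> and \<open>i\<close> are left
  out.\<close>

lemma back_odd:
  assumes "odd (i + j)" "j + 2 \<le> i" "i \<le> k + 2"
  shows "E i j"
proof -
  have "j + 3 \<le> i" using assms by presburger
  then consider "i = j + 3" | "j + 5 \<le> i" "odd j" | "j + 5 \<le> i" "even j"
    using assms by atomize_elim presburger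
  then show ?thesis
  proof cases
    case 1
    then show ?thesis using back_3[of j] assms by simp
  next
    case 2
    have "E (k + 2) (j + 1)" "E (i - 3) 0"
      by (rule back_last_even back_first_odd; use 2 assms in presburger)+
    show ?thesis
      by (rule linked_back,
          rule linked_3[where m = "k+2" and b = "j+1" and c = "i-3" and e = 0];
          (fact | use 2 assms in presburger))
  next
    case 3
    have "E (k + 2) (j + 2)" "E (i - 2) 0"
      by (rule back_last_even back_first_odd; use 3 assms in presburger)+
    show ?thesis
      by (rule linked_back,
          rule linked_3[where m = "k+2" and b = "j+2" and c = "i-2" and e = 0];
          (fact | use 3 assms in presburger))
  qed
qed

text \<open>A same-parity arc \<open>m\<close> to \<open>b\<close>, used as one jump of a path with
  \<open>k + 1\<close> vertices, produces another whose tail is closer to \<open>k + 2\<close> or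
  whose head is closer to \<open>0\<close>. The measure falls until the arc is \<open>k+1\<close> to
  \<open>0\<close> or \<open>k+2\<close> to \<open>1\<close>, and the latter gives the former
  directly.\<close>

lemma back_even_normalise:
  assumes "E m b" "b + 2 \<le> m" "m \<le> k + 2" "even (m + b)"
  shows "E (k + 1) 0"
  using assms
proof (induction "k + 2 - m + b" arbitrary: m b rule: less_induct)
  case less
  have E: "E m b" and bm: "b + 2 \<le> m" and mk: "m \<le> k + 2" and par: "even (m + b)"
    using less.prems by auto
  have IH: "E (k + 1) 0"
    if "E i j" "j + 2 \<le> i" "i \<le> k + 2" "even (i + j)" "k + 2 - i + j < k + 2 - m + b" for i j
    using less.hyps that by blast
  consider (a) "m = k + 1" "b = 0" | (b) "m = k + 1" "2 \<le> b" "even b"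
    | (c) "even m" "m + 2 \<le> k + 1" "b = 0" | (d) "even m" "m + 2 \<le> k + 1" "2 \<le> b" "even b"
    | (e) "m = k + 2" "b = 1" | (f) "m = k + 2" "3 \<le> b" "odd b" "b \<le> k"
    | (g) "odd m" "m \<le> k" "b = 1" | (h) "odd m" "m \<le> k" "3 \<le> b" "odd b"
    using par bm mk k_odd by atomize_elim presburger
  then show ?case
  proof cases
    case a
    then show ?thesis using E by auto
  next
    case b
    have "E k 0" by (rule back_odd; use k_odd k_ge in presburger)+
    have "E (k + 1) (b - 2)"
      by (rule linked_back,
          rule linked_3[where m = m and b = b and c = k and e = 0];
          (fact | use b bm in presburger))
    show ?thesis
      by (rule IH[of "k + 1" "(b - 2)"]; (fact | use b bm par k_odd in presburger))
  next
    case c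
    have "E (k + 2) 2" by (rule back_odd; use k_odd k_ge in presburger)+
    have "E (m + 2) 0"
      by (rule linked_back,
          rule linked_3[where m = "k+2" and b = 2 and c = m and e = b];
          (fact | use c bm in presburger))
    show ?thesis
      by (rule IH[of "m + 2" "0"]; (fact | use c bm par k_odd in presburger))
  next
    case d
    \<comment> \<open>Four segments \<open>m+2..k+2\<close>, \<open>b+2..m\<close>,
      \<open>b..b+1\<close>, \<open>0..b-2\<close>, omitting \<open>m+1\<close> and
      \<open>b-1\<close>: both ends of the arc move outwards at once. The outer jumps join opposite
      parities.\<close>
    have "E (k + 2) (b + 2)" "E (b + 1) 0"
      by (rule back_odd; use d bm k_odd k_ge in presburger)+
    have "E (m + 2) (b - 2)"
      by (rule linked_back,
          rule linked_4[where m = "k+2" and b = "b+2" and c = m and e = b and f = "b+1" and g = 0];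
          (fact | use d bm in presburger))
    show ?thesis
      by (rule IH[of "m + 2" "(b - 2)"]; (fact | use d bm par k_odd in presburger))
  next
    case e
    have "E (k - 2) 0" by (rule back_odd; use k_odd k_ge in presburger)+
    show ?thesis
      by (rule linked_back,
          rule linked_3[where m = m and b = b and c = "k-2" and e = 0];
          (fact | use e k_ge in presburger))
  next
    case f
    have "E k 0" by (rule back_odd; use k_odd k_ge in presburger)+
    have "E (k + 2) (b - 2)"
      by (rule linked_back,
          rule linked_3[where m = m and b = b and c = k and e = 0];
          (fact | use f bm in presburger))
    show ?thesis
      by (rule IH[of "k + 2" "(b - 2)"]; (fact | use f bm par k_odd in presburger))
  next
    case g
    have "E (k + 2) 2" by (rule back_odd; use k_odd k_ge in presburger)+
    have "E (m + 2) 1"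
      by (rule linked_back,
          rule linked_3[where m = "k+2" and b = 2 and c = m and e = b];
          (fact | use g bm in presburger))
    show ?thesis
      by (rule IH[of "m + 2" "1"]; (fact | use g bm par k_odd in presburger))
  next
    case h
    have "E (k + 2) (b + 1)" "E b 0"
      by (rule back_odd; use h bm k_odd k_ge in presburger)+
    have "E (m + 2) (b - 2)"
      by (rule linked_back,
          rule linked_4[where m = "k+2" and b = "b+1" and c = m and e = b and f = b and g = 0];
          (fact | use h bm in presburger))
    show ?thesis
      by (rule IH[of "m + 2" "(b - 2)"]; (fact | use h bm par k_odd in presburger))
  qed
qed

text \<open>Beyond \<open>back_odd\<close> the arc \<open>k+1\<close> to \<open>0\<close> is the
  only new jump needed at first. It gives all arcs of span two and all arcs out of
  \<open>k+2\<close>; with these the three-segment construction of \<open>back_odd\<close> works for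
  equal parities too.\<close>

lemma back_all:
  assumes "E m b" "b + 2 \<le> m" "m \<le> k + 2" "even (m + b)" "j + 2 \<le> i" "i \<le> k + 2"
  shows "E i j"
proof -
  have first: "E (k + 1) 0" using back_even_normalise assms by blast
  have last1: "E (k + 2) 1"
  proof -
    have "E (k + 2) 4" by (rule back_odd; use k_odd k_ge in presburger)+
    show ?thesis
      by (rule linked_back,
          rule linked_3[where m = "k+2" and b = 4 and c = "k+1" and e = 0];
          (fact | use k_ge in presburger))
  qed
  \<comment> \<open>The two segments skip \<open>i - 1\<close> and one end of \<open>P\<close>:
    index \<open>0\<close> if \<open>i = k + 2\<close>, and index \<open>k + 2\<close>
    otherwise.\<close>
  have two: "E i (i - 2)" if "2 \<le> i" "i \<le> k + 2" for i
  proof (cases "i = k + 2")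
    case True
    show ?thesis
      by (rule linked_back,
          rule linked_2[where m = "k+2" and b = 1];
          (fact | use True k_ge in presburger))
  next
    case False
    show ?thesis
      by (rule linked_back,
          rule linked_2[where m = "k+1" and b = 0];
          (fact | use that False in presburger))
  qed
  have last: "E (k + 2) j" if jk: "j \<le> k" for j
  proof -
    consider "even j" | "odd j" "j + 4 \<le> k" | "j = k - 2" | "j = k"
      using jk k_odd by atomize_elim presburger
    then show ?thesis
    proof cases
      case 1
      show ?thesis by (rule back_odd; use 1 jk k_odd in presburger)+
    next
      case 2
      have "E (k + 2) (j + 3)" by (rule back_odd; use 2 k_odd in presburger)+
      show ?thesis
      by (rule linked_back,
          rule linked_3[where m = "k+2" and b = "j+3" and c = "k+1" and e = 0];
          (fact | use 2 in presburger))
    next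
      case 3
      have "E (k + 2) k" using two[of "k + 2"] by simp
      have "E (k + 1) 1" by (rule back_odd; use k_odd k_ge in presburger)
      show ?thesis
      by (rule linked_back,
          rule linked_3[where m = "k+2" and b = k and c = "k+1" and e = 1];
          (fact | use 3 k_ge in presburger))
    next
      case 4
      then show ?thesis using two[of "k + 2"] by simp
    qed
  qed
  consider "odd (i + j)" | "i = j + 2" | "i = 4" "j = 0" | "even j" "j + 4 \<le> i" "even i" "6 \<le> i"
    | "odd j" "j + 4 \<le> i" "odd i"
    using assms(5) by atomize_elim presburger
  then show ?thesis
  proof cases
    case 1
    then show ?thesis using assms(5,6) by (rule back_odd)
  next
    case 2
    then show ?thesis using two[of i] assms(6) by simp
  next
    case 3
    have "E 3 0" "E (k + 2) 3" using back_3[of 0] last k_ge by auto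
    show ?thesis
      by (rule linked_back,
          rule linked_3[where m = "k+2" and b = 3 and c = 3 and e = 0];
          (fact | use 3 k_ge in presburger))
  next
    case 4
    have "E (i - 3) 0" by (rule back_odd; use 4 assms(6) in presburger)
    have "E (k + 2) (j + 1)" by (rule last; use 4 assms(6) in presburger)
    show ?thesis
      by (rule linked_back,
          rule linked_3[where m = "k+2" and b = "j+1" and c = "i-3" and e = 0];
          (fact | use 4 assms(6) in presburger))
  next
    case 5
    have "E (i - 2) 0" by (rule back_odd; use 5 assms(6) in presburger)
    have "E (k + 2) (j + 2)" by (rule last; use 5 assms(6) in presburger)
    show ?thesis
      by (rule linked_back,
          rule linked_3[where m = "k+2" and b = "j+2" and c = "i-2" and e = 0];
          (fact | use 5 assms(6) in presburger))
  qed
qed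

lemma back_dichotomy:
  assumes loopfree: "\<And>a. (a, a) \<notin> A"
  shows "\<exists>d::nat. (d = 1 \<or> d = 2) \<and>
    (\<forall>i j. j + 2 \<le> i \<longrightarrow> i \<le> k + 2 \<longrightarrow> d = 1 \<or> odd (i + j) \<longrightarrow> E i j) \<and>
    (\<forall>i j. i \<le> k + 2 \<longrightarrow> j \<le> k + 2 \<longrightarrow> E i j \<longrightarrow> d = 1 \<or> odd (i + j))"
proof (cases "\<exists>m b. E m b \<and> b + 2 \<le> m \<and> m \<le> k + 2 \<and> even (m + b)")
  case True
  then obtain m b where "E m b" "b + 2 \<le> m" "m \<le> k + 2" "even (m + b)" by blast
  then have "\<And>i j. j + 2 \<le> i \<Longrightarrow> i \<le> k + 2 \<Longrightarrow> E i j" using back_all by blast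
  then show ?thesis by (intro exI[of _ 1]) blast
next
  case False
  have "odd (i + j)" if ij: "i \<le> k + 2" "j \<le> k + 2" "E i j" for i j
  proof -
    have "i \<noteq> j" using loopfree that by auto
    then consider "j = Suc i" | "j + 1 = i" | "j + 2 \<le> i" using geodesic1[OF ij] by linarith
    then show ?thesis
    proof cases
      case 3
      then show ?thesis using False ij by blast
    qed auto
  qed
  moreover have "E i j" if "j + 2 \<le> i" "i \<le> k + 2" "(2::nat) = 1 \<or> odd (i + j)" for i j
    using back_odd that by simp
  ultimately show ?thesis by (intro exI[of _ 2]) blast
qed

section \<open>Vertices outside the geodesic\<close>

definition outs :: "'a \<Rightarrow> nat set" where
  "outs w = {i. i \<le> k + 2 \<and> (w, x i) \<in> A}"

definition ins :: "'a \<Rightarrow> nat set" where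
  "ins w = {i. i \<le> k + 2 \<and> (x i, w) \<in> A}"

definition nbs :: "'a \<Rightarrow> nat set" where
  "nbs w = outs w \<union> ins w"

lemma nbs_iff: "i \<in> nbs w \<longleftrightarrow> i \<le> k + 2 \<and> adjacent A w (x i)"
  by (auto simp: nbs_def outs_def ins_def adjacent_def)

lemma outs_le: "i \<in> outs w \<Longrightarrow> i \<le> k + 2"
  by (simp add: outs_def)

lemma ins_le: "i \<in> ins w \<Longrightarrow> i \<le> k + 2"
  by (simp add: ins_def)

lemma outs_ins_le: "i \<in> outs w \<Longrightarrow> j \<in> ins w \<Longrightarrow> i \<le> j + 2"
  using geodesic2[of j i w] by (simp add: outs_def ins_def)

lemma ins_arc_outs_le: "j \<in> ins w \<Longrightarrow> (w, w') \<in> A \<Longrightarrow> i \<in> outs w' \<Longrightarrow> i \<le> j + 3"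
  using geodesic3[of j i w w'] by (simp add: outs_def ins_def)

text \<open>Outer path \<open>p\<close>, then \<open>m\<close> vertices of \<open>P\<close>, then
  outer path \<open>q\<close>. Either outer path may be empty; \<open>hd (p @ [x i])\<close> and
  \<open>last (x j # q)\<close> then name the end on \<open>P\<close>.\<close>

lemma bridge:
  assumes "distinct (p @ q)" "set (p @ q) \<inter> S = {}" "arcwise A p" "arcwise A q"
    and "linked i j m" "p \<noteq> [] \<Longrightarrow> i \<in> outs (last p)" "q \<noteq> [] \<Longrightarrow> j \<in> ins (hd q)"
    and "length p + m + length q = k + 1"
  shows "adjacent A (hd (p @ [x i])) (last (x j # q))"
proof -
  obtain r where r: "ipath r" "hd r = i" "last r = j" "length r = m"
    using assms(5) unfolding linked_def by blast
  then have ne: "r \<noteq> []" and rS: "set (map x r) \<subseteq> S" by (auto simp: ipath_def)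
  let ?L = "p @ map x r @ q"
  have "distinct ?L" using assms(1,2) distinct_map_x[OF r(1)] rS
    by (simp only: distinct_append set_append) blast
  moreover have "arcwise A ?L"
    using assms(3,4,6,7) arcwise_map[OF r(1)] r ne
    by (auto simp: successively_append_iff hd_append last_append hd_map last_map outs_def ins_def)
  moreover have "length ?L = k + 1" using assms(8) r by simp
  ultimately have "adjacent A (hd ?L) (last ?L)" by (rule kqt)
  then show ?thesis using ne r
    by (auto simp: hd_append last_append hd_map last_map split: if_splits)
qed

text \<open>Complementary to \<open>bridge\<close>: here the path starts and ends on
  \<open>P\<close> and visits \<open>w\<close> in between.\<close>

lemma through:
  assumes "ipath p" "ipath q" "set p \<inter> set q = {}" "w \<notin> S"
    and "last p \<in> ins w" "hd q \<in> outs w" "length p + length q = k"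
  shows "adjacent A (x (hd p)) (x (last q))"
proof -
  have ne: "p \<noteq> []" "q \<noteq> []" using assms by (auto simp: ipath_def)
  let ?L = "map x p @ w # map x q"
  have "set p \<subseteq> {..k+2}" "set q \<subseteq> {..k+2}" using assms by (auto simp: ipath_def)
  then have "x ` set p \<inter> x ` set q = {}"
    using assms(3) inj_x inj_on_image_Int[of x "{..k+2}" "set p" "set q"] by simp
  then have "distinct ?L"
    using assms distinct_map_x[OF assms(1)] distinct_map_x[OF assms(2)] by (auto simp: ipath_def)
  moreover have "arcwise A ?L"
    using assms(5,6) arcwise_map[OF assms(1)] arcwise_map[OF assms(2)] ne
    by (auto simp: successively_append_iff successively_Cons hd_map last_map outs_def ins_def)
  moreover have "length ?L = k + 1" using assms by simp
  ultimately have "adjacent A (hd ?L) (last ?L)" by (rule kqt)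
  then show ?thesis using ne by (auto simp: hd_map last_map)
qed

end

section \<open>Paths of prescribed length inside the geodesic, uniformly in \<open>d\<close>\<close>

text \<open>The condition \<open>d = 1 \<or> odd (i + j)\<close> is \<open>d dvd i + j + 1\<close>, written so that \<open>presburger\<close> can decide it.\<close>

locale kqt_geodesic_mod = kqt_geodesic A k x
  for A :: "('a \<times> 'a) set" and k x +
  fixes d :: nat and V :: "'a set"
  assumes d: "d = 1 \<or> d = 2"
    and back_arc: "\<And>i j. j + 2 \<le> i \<Longrightarrow> i \<le> k + 2 \<Longrightarrow> d = 1 \<or> odd (i + j) \<Longrightarrow> E i j"
    and arc_mod: "\<And>i j. i \<le> k + 2 \<Longrightarrow> j \<le> k + 2 \<Longrightarrow> E i j \<Longrightarrow> d = 1 \<or> odd (i + j)"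
    and loopfree: "\<And>a. (a, a) \<notin> A"
    and arcs_V: "A \<subseteq> V \<times> V" and x_V: "S \<subseteq> V"
    and conn: "\<And>a b. a \<in> V \<Longrightarrow> b \<in> V \<Longrightarrow> (a, b) \<in> A\<^sup>*"
begin

text \<open>The witnesses below are descending segments \<open>[i..m], [b..j]\<close> or \<open>[i..m], [b..c], [e..j]\<close>
  of \<open>P\<close> that together omit exactly three (for \<open>k\<close> vertices) or four (for \<open>k - 1\<close>) of the \<open>k + 3\<close> indices.\<close>

lemma linked_k:
  assumes "j < i" "i \<le> k + 2" "d = 1 \<or> even (i + j)"
  shows "linked i j k"
proof -
  consider "i = j + 1" "3 \<le> j" "d = 1" | "i = j + 1" "j \<le> 2" "d = 1" | "i = j + 2" "2 \<le> j"
    | "i = j + 2" "j \<le> 1" | "i = j + 3" "1 \<le> j" "d = 1" | "i = j + 3" "j = 0" "d = 1"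
    | "i = j + 4" | "j + 5 \<le> i" "even j" | "j + 5 \<le> i" "odd j"
    using assms by atomize_elim presburger
  then show ?thesis
  proof cases
    case 1
    show ?thesis
      by (rule linked_2[where m = "k+2" and b = 3]; (rule back_arc)?;
          use 1 assms k_odd k_ge in presburger)
  next
    case 2
    show ?thesis
      by (rule linked_2[where m = "k-1" and b = 0]; (rule back_arc)?;
          use 2 assms k_odd k_ge in presburger)
  next
    case 3
    show ?thesis
      by (rule linked_2[where m = "k+2" and b = 2]; (rule back_arc)?;
          use 3 assms k_odd k_ge in presburger)
  next
    case 4
    show ?thesis
      by (rule linked_2[where m = k and b = 0]; (rule back_arc)?;
          use 4 assms k_odd k_ge in presburger)
  next
    case 5
    show ?thesis
      by (rule linked_2[where m = "k+2" and b = 1]; (rule back_arc)?;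
          use 5 assms k_odd k_ge in presburger)
  next
    case 6
    show ?thesis
      by (rule linked_2[where m = "k+1" and b = 0]; (rule back_arc)?;
          use 6 assms k_odd k_ge in presburger)
  next
    case 7
    show ?thesis
      by (rule linked_2[where m = "k+2" and b = 0]; (rule back_arc)?;
          use 7 assms k_odd k_ge in presburger)
  next
    case 8
    show ?thesis
      by (rule linked_3[where m = "k+2" and b = "j+2" and c = "i-3" and e = 0]; (rule back_arc)?;
          use 8 assms k_odd k_ge in presburger)
  next
    case 9
    show ?thesis
      by (rule linked_3[where m = "k+2" and b = "j+1" and c = "i-4" and e = 0]; (rule back_arc)?;
          use 9 assms k_odd k_ge in presburger)
  qed
qed

lemma linked_k_minus_1:
  assumes "j < i" "i \<le> k + 2" "d = 1 \<or> odd (i + j)"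
  shows "linked i j (k - 1)"
proof -
  consider "i = j + 1" "4 \<le> j" | "i = j + 1" "j = 3" | "i = j + 1" "j \<le> 2"
    | "i = j + 2" "3 \<le> j" "d = 1" | "i = j + 2" "j \<le> 2" "d = 1"
    | "i = j + 3" "2 \<le> j" | "i = j + 3" "j \<le> 1"
    | "i = j + 4" "1 \<le> j" "d = 1" | "i = j + 4" "j = 0" "d = 1"
    | "i = j + 5" | "j + 6 \<le> i" "even j" | "j + 6 \<le> i" "odd j"
    using assms by atomize_elim presburger
  then show ?thesis
  proof cases
    case 1
    show ?thesis
      by (rule linked_2[where m = "k+2" and b = 4]; (rule back_arc)?;
          use 1 assms k_odd k_ge in presburger)
  next
    case 2
    show ?thesis
      by (rule linked_2[where m = "k+1" and b = 3]; (rule back_arc)?;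
          use 2 assms k_odd k_ge in presburger)
  next
    case 3
    show ?thesis
      by (rule linked_2[where m = "k-2" and b = 0]; (rule back_arc)?;
          use 3 assms k_odd k_ge in presburger)
  next
    case 4
    show ?thesis
      by (rule linked_2[where m = "k+2" and b = 3]; (rule back_arc)?;
          use 4 assms k_odd k_ge in presburger)
  next
    case 5
    show ?thesis
      by (rule linked_2[where m = "k-1" and b = 0]; (rule back_arc)?;
          use 5 assms k_odd k_ge in presburger)
  next
    case 6
    show ?thesis
      by (rule linked_2[where m = "k+2" and b = 2]; (rule back_arc)?;
          use 6 assms k_odd k_ge in presburger)
  next
    case 7
    show ?thesis
      by (rule linked_2[where m = k and b = 0]; (rule back_arc)?;
          use 7 assms k_odd k_ge in presburger)
  next
    case 8
    show ?thesis
      by (rule linked_2[where m = "k+2" and b = 1]; (rule back_arc)?;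
          use 8 assms k_odd k_ge in presburger)
  next
    case 9
    show ?thesis
      by (rule linked_2[where m = "k+1" and b = 0]; (rule back_arc)?;
          use 9 assms k_odd k_ge in presburger)
  next
    case 10
    show ?thesis
      by (rule linked_2[where m = "k+2" and b = 0]; (rule back_arc)?;
          use 10 assms k_odd k_ge in presburger)
  next
    case 11
    show ?thesis
      by (rule linked_3[where m = "k+2" and b = "j+2" and c = "i-4" and e = 0]; (rule back_arc)?;
          use 11 assms k_odd k_ge in presburger)
  next
    case 12
    show ?thesis
      by (rule linked_3[where m = "k+2" and b = "j+1" and c = "i-5" and e = 0]; (rule back_arc)?;
          use 12 assms k_odd k_ge in presburger)
  qed
qed

text \<open>The jump is \<open>k+2\<close> to \<open>0\<close>, whose ends have opposite parity, so
  it exists for both values of \<open>d\<close>.\<close>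

lemma linked_wrap:
  assumes "j < i" "i \<le> k + 2" "m + i = j + k + 4"
  shows "linked i j m"
  by (rule linked_2[where m = "k+2" and b = 0]; (rule back_arc)?; use assms k_odd k_ge in presburger)

text \<open>Walk \<open>m\<close> vertices around the cycle formed by \<open>P\<close> and the arc
  \<open>k+2\<close> to \<open>0\<close>. The cycle has the even length \<open>k + 3\<close>, so
  wrapping around does not disturb the parity of the end.\<close>

lemma linked_from:
  assumes "i \<le> k + 2" "1 \<le> m" "m \<le> k + 2"
  obtains j where "linked i j m" "j \<le> k + 2" "odd (i + m + j)"
proof (cases "i + m \<le> k + 3")
  case True
  show ?thesis by (rule that[of "i + m - 1"], rule linked_ivl; use True assms in presburger)
next
  case False
  show ?thesis by (rule that[of "i + m - k - 4"], rule linked_wrap; use False assms k_odd in presburger)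
qed

lemma linked_to:
  assumes "j \<le> k + 2" "1 \<le> m" "m \<le> k + 2"
  obtains i where "linked i j m" "i \<le> k + 2" "odd (i + m + j)"
proof (cases "m \<le> j + 1")
  case True
  show ?thesis by (rule that[of "j + 1 - m"], rule linked_ivl; use True assms in presburger)
next
  case False
  show ?thesis by (rule that[of "j + k + 4 - m"], rule linked_wrap; use False assms k_odd in presburger)
qed

section \<open>Reversal\<close>

text \<open>The reflection \<open>i\<close> to \<open>k + 2 - i\<close> preserves the parity of sums
  \<open>i + j\<close>, so the same \<open>d\<close> serves the reversed digraph.\<close>

lemma reverse: "kqt_geodesic_mod (A\<inverse>) k (\<lambda>i. x (k + 2 - i)) d V"
proof
  fix p assume p: "distinct p" "arcwise (A\<inverse>) p" "length p = k + 1"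
  have "arcwise A (rev p)" using p(2) by (simp add: successively_rev)
  then have "adjacent A (hd (rev p)) (last (rev p))" using p by (intro kqt) auto
  moreover have "p \<noteq> []" using p by auto
  ultimately show "adjacent (A\<inverse>) (hd p) (last p)"
    by (auto simp: hd_rev last_rev adjacent_def)
next
  show "inj_on (\<lambda>i. x (k + 2 - i)) {..k+2}"
    by (rule inj_onI) (auto simp: x_eq_iff)
next
  fix i assume "i < k + 2"
  then have "(x (k + 2 - Suc i), x (Suc (k + 2 - Suc i))) \<in> A" by (intro step) auto
  then show "(x (k + 2 - i), x (k + 2 - Suc i)) \<in> A\<inverse>" using \<open>i < k + 2\<close> by (simp add: Suc_diff_le)
next
  fix i j l assume ij: "i \<le> k + 2" "j \<le> k + 2" "(x (k + 2 - i), x (k + 2 - j)) \<in> A\<inverse> ^^ l"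
  have "(x (k + 2 - j), x (k + 2 - i)) \<in> A ^^ l"
    using ij(3) by (simp add: relpow_converse)
  from geodesic[OF _ _ this] show "j \<le> i + l" using ij by auto
next
  show "(\<lambda>i. x (k + 2 - i)) ` {..k+2} \<subseteq> V" using x_V by auto
next
  fix i j assume ij: "j + 2 \<le> i" "i \<le> k + 2" "d = 1 \<or> odd (i + j)"
  have "E (k + 2 - j) (k + 2 - i)" by (rule back_arc; use ij in presburger)
  then show "(x (k + 2 - i), x (k + 2 - j)) \<in> A\<inverse>" by simp
next
  fix i j assume ij: "i \<le> k + 2" "j \<le> k + 2" "(x (k + 2 - i), x (k + 2 - j)) \<in> A\<inverse>"
  then have "d = 1 \<or> odd ((k + 2 - j) + (k + 2 - i))" by (intro arc_mod) auto
  then show "d = 1 \<or> odd (i + j)" using ij(1,2) by presburger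
next
  fix a b assume "a \<in> V" "b \<in> V"
  then show "(a, b) \<in> (A\<inverse>)\<^sup>*" using conn by (simp add: rtrancl_converse)
qed (use k_odd k_ge d arcs_V loopfree in auto)

lemma rev_S: "(\<lambda>i. x (k + 2 - i)) ` {..k+2} = S"
proof -
  have "j \<in> (\<lambda>i. k + 2 - i) ` {..k+2}" if "j \<le> k + 2" for j
    by (rule image_eqI[of _ _ "k + 2 - j"]) (use that in auto)
  then have "(\<lambda>i. k + 2 - i) ` {..k+2} = {..k+2}" by auto
  then show ?thesis by (metis image_image)
qed

lemma rev_outs:
  "kqt_geodesic.outs (A\<inverse>) k (\<lambda>i. x (k + 2 - i)) w = {i. i \<le> k + 2 \<and> k + 2 - i \<in> ins w}"
proof -
  interpret rv: kqt_geodesic_mod "A\<inverse>" k "\<lambda>i. x (k + 2 - i)" d V by (rule reverse)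
  show ?thesis unfolding rv.outs_def ins_def by auto
qed

lemma rev_ins:
  "kqt_geodesic.ins (A\<inverse>) k (\<lambda>i. x (k + 2 - i)) w = {i. i \<le> k + 2 \<and> k + 2 - i \<in> outs w}"
proof -
  interpret rv: kqt_geodesic_mod "A\<inverse>" k "\<lambda>i. x (k + 2 - i)" d V by (rule reverse)
  show ?thesis unfolding rv.ins_def outs_def by auto
qed

lemma rev_nbs:
  "kqt_geodesic.nbs (A\<inverse>) k (\<lambda>i. x (k + 2 - i)) w = {i. i \<le> k + 2 \<and> k + 2 - i \<in> nbs w}"
proof -
  interpret rv: kqt_geodesic_mod "A\<inverse>" k "\<lambda>i. x (k + 2 - i)" d V by (rule reverse)
  show ?thesis unfolding rv.nbs_def nbs_def rev_outs rev_ins by auto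
qed

lemma rev_set_empty:
  assumes "M \<subseteq> {..k+2}"
  shows "{i. i \<le> k + 2 \<and> k + 2 - i \<in> M} = {} \<longleftrightarrow> M = {}"
proof
  assume *: "{i. i \<le> k + 2 \<and> k + 2 - i \<in> M} = {}"
  have "i \<notin> M" for i
  proof
    assume "i \<in> M"
    then have "k + 2 - i \<in> {i. i \<le> k + 2 \<and> k + 2 - i \<in> M}" using assms by auto
    then show False using * by simp
  qed
  then show "M = {}" by blast
qed simp

lemma outs_subset: "outs w \<subseteq> {..k+2}"
  by (auto simp: outs_def)

lemma ins_subset: "ins w \<subseteq> {..k+2}"
  by (auto simp: ins_def)

lemma rev_outs_empty: "kqt_geodesic.outs (A\<inverse>) k (\<lambda>i. x (k + 2 - i)) w = {} \<longleftrightarrow> ins w = {}"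
  unfolding rev_outs by (rule rev_set_empty[OF ins_subset])

lemma rev_ins_empty: "kqt_geodesic.ins (A\<inverse>) k (\<lambda>i. x (k + 2 - i)) w = {} \<longleftrightarrow> outs w = {}"
  unfolding rev_ins by (rule rev_set_empty[OF outs_subset])

lemma rev_mem: "i \<in> M \<Longrightarrow> M \<subseteq> {..k+2} \<Longrightarrow> k + 2 - i \<in> {i. i \<le> k + 2 \<and> k + 2 - i \<in> M}"
  by auto

section \<open>Neighbours on the geodesic\<close>

text \<open>From \<open>w\<close> enter \<open>P\<close> at \<open>i\<close> and use
  \<open>k\<close> vertices ending at \<open>j\<close>; together with \<open>w\<close> this is a
  path of length \<open>k\<close>.\<close>

lemma out_nbs:
  assumes "i \<in> outs w" "w \<notin> S" "j < i" "d = 1 \<or> even (i + j)"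
  shows "j \<in> nbs w"
proof -
  have "i \<le> k + 2" using assms(1) by (rule outs_le)
  then have "linked i j k" using assms by (intro linked_k) auto
  then have "adjacent A w (x j)" using bridge[of "[w]" "[]" i j k] assms by simp
  then show ?thesis using assms(3) \<open>i \<le> k + 2\<close> by (simp add: nbs_iff)
qed

text \<open>The plain segment of \<open>k\<close> vertices from \<open>i\<close> is used;
  \<open>i \<le> 3\<close> is exactly what makes it fit. As \<open>k - 1\<close> is even, the class
  is kept.\<close>

lemma out_nbs_wrap:
  assumes "i \<in> outs w" "w \<notin> S" "i \<le> 3"
  shows "i + k - 1 \<in> nbs w"
proof -
  have "linked i (i + k - 1) k" using assms k_ge by (intro linked_ivl) auto
  then have "adjacent A w (x (i + k - 1))" using bridge[of "[w]" "[]" i "i + k - 1" k] assms by simp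
  then show ?thesis using assms(3) k_ge by (simp add: nbs_iff)
qed

lemma in_nbs:
  assumes "i \<in> ins w" "w \<notin> S" "i < j" "j \<le> k + 2" "d = 1 \<or> even (i + j)"
  shows "j \<in> nbs w"
proof -
  interpret rv: kqt_geodesic_mod "A\<inverse>" k "\<lambda>i. x (k + 2 - i)" d V by (rule reverse)
  have "k + 2 - j \<in> {i. i \<le> k + 2 \<and> k + 2 - i \<in> nbs w}"
    unfolding rev_nbs[symmetric]
  proof (rule rv.out_nbs)
    show "k + 2 - i \<in> rv.outs w" unfolding rev_outs by (rule rev_mem[OF assms(1) ins_subset])
    show "w \<notin> rv.S" unfolding rev_S by (rule assms(2))
    show "k + 2 - j < k + 2 - i" using assms(3,4) by linarith
    show "d = 1 \<or> even (k + 2 - i + (k + 2 - j))" using assms(3-5) by presburger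
  qed
  then show ?thesis using assms(4) by simp
qed

lemma in_nbs_wrap:
  assumes "i \<in> ins w" "w \<notin> S" "k - 1 \<le> i"
  shows "i + 1 - k \<in> nbs w"
proof -
  interpret rv: kqt_geodesic_mod "A\<inverse>" k "\<lambda>i. x (k + 2 - i)" d V by (rule reverse)
  have "k + 2 - i + k - 1 \<in> {i. i \<le> k + 2 \<and> k + 2 - i \<in> nbs w}"
    unfolding rev_nbs[symmetric]
  proof (rule rv.out_nbs_wrap)
    show "k + 2 - i \<in> rv.outs w" unfolding rev_outs by (rule rev_mem[OF assms(1) ins_subset])
    show "w \<notin> rv.S" unfolding rev_S by (rule assms(2))
    show "k + 2 - i \<le> 3" using assms(3) by linarith
  qed
  moreover have "k + 2 - (k + 2 - i + k - 1) = i + 1 - k"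
    using ins_le[OF assms(1)] k_ge by linarith
  ultimately show ?thesis by simp
qed

text \<open>An arc from \<open>x j\<close> into \<open>w\<close> would give a two-step shortcut from
  \<open>j\<close> to \<open>i\<close>, so the neighbour found by \<open>out_nbs\<close> must be an
  out-neighbour.\<close>

lemma outs_below:
  assumes "i \<in> outs w" "w \<notin> S" "j + 3 \<le> i" "d = 1 \<or> even (i + j)"
  shows "j \<in> outs w"
proof -
  have "j \<in> nbs w" using out_nbs[OF assms(1,2) _ assms(4)] assms(3) by simp
  moreover have "j \<notin> ins w" using outs_ins_le[OF assms(1), of j] assms(3) by auto
  ultimately show ?thesis by (simp add: nbs_def)
qed

lemma ins_above:
  assumes "i \<in> ins w" "w \<notin> S" "i + 3 \<le> j" "j \<le> k + 2" "d = 1 \<or> even (i + j)"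
  shows "j \<in> ins w"
proof -
  have "j \<in> nbs w" using in_nbs[OF assms(1,2) _ assms(4,5)] assms(3) by simp
  moreover have "j \<notin> outs w" using outs_ins_le[of j w i] assms(1,3) by auto
  ultimately show ?thesis by (simp add: nbs_def)
qed

text \<open>Without arcs into \<open>w\<close>, every neighbour is an out-neighbour, so
  \<open>out_nbs\<close> (downwards) and \<open>out_nbs_wrap\<close> (upwards by
  \<open>k - 1\<close>) can be iterated through the whole class.\<close>

lemma outs_full:
  assumes "i \<in> outs w" "w \<notin> S" "ins w = {}" "j \<le> k + 2" "d = 1 \<or> even (i + j)"
  shows "j \<in> outs w"
proof -
  have nbs: "nbs w = outs w" using assms(3) by (simp add: nbs_def)
  \<comment> \<open>The least index in the class of \<open>i\<close>.\<close>
  define c where "c = (if d = 1 then 0 else i mod 2)"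
  have c: "c \<le> 1" "c \<le> i" "d = 1 \<or> even (i + c)" unfolding c_def by presburger+
  have cout: "c \<in> outs w"
    using out_nbs[OF assms(1,2), of c] c assms(1) by (cases "c = i") (auto simp: nbs)
  have big: "c + k - 1 \<in> outs w"
    using out_nbs_wrap[OF cout assms(2)] c(1) by (simp add: nbs)
  have low: "j' \<in> outs w" if j': "j' \<le> c + k - 1" "d = 1 \<or> even (i + j')" for j'
  proof (cases "j' = c + k - 1")
    case False
    show ?thesis unfolding nbs[symmetric]
      by (rule out_nbs[OF big assms(2)]; use False j' c k_odd k_ge in presburger)
  qed (use big in simp)
  show ?thesis
  proof (cases "j \<le> c + k - 1")
    case True
    then show ?thesis using low assms(5) by blast
  next
    case False
    then have "k \<le> j" by linarith
    then have "d = 1 \<or> even (i + (j + 1 - k))" using k_odd assms(5) by presburger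
    moreover have "j + 1 - k \<le> c + k - 1" using assms(4) k_ge by linarith
    ultimately have "j + 1 - k \<in> outs w" by (intro low)
    then have "(j + 1 - k) + k - 1 \<in> outs w"
      using out_nbs_wrap[of "j + 1 - k" w] assms(2,4) k_ge by (simp add: nbs)
    moreover have "(j + 1 - k) + k - 1 = j" using False by linarith
    ultimately show ?thesis by simp
  qed
qed

lemma ins_full:
  assumes "i \<in> ins w" "w \<notin> S" "outs w = {}" "j \<le> k + 2" "d = 1 \<or> even (i + j)"
  shows "j \<in> ins w"
proof -
  interpret rv: kqt_geodesic_mod "A\<inverse>" k "\<lambda>i. x (k + 2 - i)" d V by (rule reverse)
  have "k + 2 - j \<in> {i. i \<le> k + 2 \<and> k + 2 - i \<in> ins w}"
    unfolding rev_outs[symmetric]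
  proof (rule rv.outs_full)
    show "k + 2 - i \<in> rv.outs w" unfolding rev_outs by (rule rev_mem[OF assms(1) ins_subset])
    show "w \<notin> rv.S" unfolding rev_S by (rule assms(2))
    show "rv.ins w = {}" using assms(3) by (simp only: rev_ins_empty)
    show "d = 1 \<or> even (k + 2 - i + (k + 2 - j))"
      using ins_le[OF assms(1)] assms(4,5) by presburger
  qed simp
  then show ?thesis using assms(4) by simp
qed

text \<open>If the classes differed, then \<open>d = 2\<close>, and a path of length
  \<open>k\<close> through \<open>w\<close> whose ends have equal parity would join two nonadjacent
  vertices of \<open>P\<close>. The neighbours are first pushed to extreme positions:
  \<open>0\<close> and \<open>k+2\<close> for even \<open>i\<close>, \<open>1\<close> and
  \<open>k+1\<close> for odd \<open>i\<close>. What resists the push is confined to a few positions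
  near the ends by \<open>i \<le> j + 2\<close>.\<close>

lemma outs_ins_same_class:
  assumes out: "i \<in> outs w" and inn: "j \<in> ins w" and w: "w \<notin> S"
  shows "d = 1 \<or> even (i + j)"
proof (rule ccontr)
  assume "\<not> ?thesis"
  then have d2: "d \<noteq> 1" and odd: "odd (i + j)" by auto
  have nonadj: "\<not> adjacent A (x a) (x b)" if "a \<le> k + 2" "b \<le> k + 2" "even (a + b)" for a b
    using arc_mod[of a b] arc_mod[of b a] that d2 by (auto simp: adjacent_def add.commute)
  have thr: False if "ipath p" "ipath q" "set p \<inter> set q = {}" "last p \<in> ins w" "hd q \<in> outs w"
    "length p + length q = k" "even (hd p + last q)" for p q
    using through[OF that(1-3) w that(4-6)] nonadj[of "hd p" "last q"] that(7)
      ipath_bounds[OF that(1)] ipath_bounds[OF that(2)] by simp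
  have thr1: False if ab: "a \<le> j'" "i' \<le> b" "b < a" "j' \<in> ins w" "i' \<in> outs w" "a \<le> b + 4" "even (a + b)"
      "j' + b + 2 = k + a + i'" for a b i' j'
  proof (rule thr[of "ivl a j'" "ivl i' b"])
    show "ipath (ivl a j')" "ipath (ivl i' b)"
      using ab ins_le[OF ab(4)] by (auto intro!: ipath_ivl)
  qed (use ab in \<open>simp_all add: ivl_simps\<close>)
  note le = outs_ins_le
  have low: "i' \<in> outs w \<or> i' \<in> ins w \<and> i \<le> i' + 2" if "i' \<le> i" "even (i + i')" for i'
    using out_nbs[OF out w, of i'] that out le[OF out] by (cases "i' = i") (auto simp: nbs_def)
  have high: "j' \<in> ins w \<or> j' \<in> outs w \<and> j' \<le> j + 2" if "j \<le> j'" "j' \<le> k + 2" "even (j + j')" for j'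
    using in_nbs[OF inn w, of j'] that inn le[OF _ inn] by (cases "j' = j") (auto simp: nbs_def)
  have ik: "i \<le> k + 2" and jk: "j \<le> k + 2" using outs_le[OF out] ins_le[OF inn] by auto
  show False
  proof (cases "even i")
    case True
    have j: "odd j" using True odd by simp
    have "0 \<in> outs w \<or> 0 \<in> ins w \<and> i \<le> 2" using low[of 0] True by auto
    then consider "0 \<in> outs w" | "0 \<notin> outs w" "0 \<in> ins w" "i \<le> 2" by blast
    then show False
    proof cases
      case 1
      have "k + 2 \<in> ins w \<or> k + 2 \<in> outs w \<and> k \<le> j"
        using high[of "k + 2"] j jk k_odd by auto
      then consider "k + 2 \<in> ins w" | "k + 2 \<in> outs w" "k \<le> j" "k + 2 \<notin> ins w" by blast
      then show False
      proof cases
        case a: 1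
        show False by (rule thr1[of 4 "k + 2" 0 0]) (use 1 a k_ge in auto)
      next
        case a: 2
        have "j \<noteq> k + 2" using a(3) inn by metis
        moreover have "j \<noteq> k + 1" using j k_odd by auto
        ultimately have "j = k" using a jk by linarith
        then show False using thr1[of 2 k 0 0] 1 inn k_ge by auto
      qed
    next
      case 2
      have "i \<noteq> 0" using 2(1) out by metis
      then have i: "i = 2" using True 2(3) by presburger
      have "k + 2 \<in> ins w" using high[of "k + 2"] j jk k_odd le[of "k + 2" w 0] 2 k_ge by auto
      then show False using thr1[of 4 "k + 2" 2 2] i out k_ge by auto
    qed
  next
    case False
    have j: "even j" using False odd by simp
    have i1: "1 \<le> i" using False by presburger
    have jk1: "j \<le> k + 1" using j jk k_odd by presburger
    have "1 \<in> outs w \<or> 1 \<in> ins w \<and> i \<le> 3" using low[of 1] False i1 by auto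
    then consider "1 \<in> outs w" | "1 \<notin> outs w" "1 \<in> ins w" "i \<le> 3" by blast
    then show False
    proof cases
      case 1
      have "k + 1 \<in> ins w \<or> k + 1 \<in> outs w \<and> k - 1 \<le> j"
        using high[of "k + 1"] j jk1 k_odd by auto
      then consider "k + 1 \<in> ins w" | "k + 1 \<in> outs w" "k - 1 \<le> j" "k + 1 \<notin> ins w" by blast
      then show False
      proof cases
        case a: 1
        show False by (rule thr1[of 3 "k + 1" 1 1]) (use 1 a k_ge in auto)
      next
        case a: 2
        have "j \<noteq> k + 1" using a(3) inn by metis
        then have j': "j = k - 1" using a jk1 j k_odd by presburger
        \<comment> \<open>No two plain segments fit here, so the part after \<open>w\<close> runs
          \<open>1, 2, 3, 0\<close>; the path goes from index \<open>4\<close> to index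
          \<open>0\<close>.\<close>
        have "E 3 0" by (rule back_arc) (use k_ge in auto)
        have "ipath (ivl 1 3 @ ivl 0 0)"
          by (intro ipath_append ipath_ivl) (use k_ge \<open>E 3 0\<close> in \<open>auto simp: ivl_simps\<close>)
        then show False
          by (intro thr[of "ivl 4 (k - 1)" "ivl 1 3 @ ivl 0 0"] ipath_ivl)
            (use 1 inn j' k_ge in \<open>auto simp: ivl_simps\<close>)
      qed
    next
      case 2
      have "i \<noteq> 1" using 2(1) out by metis
      then have i: "i = 3" using False 2(3) i1 by presburger
      have "k + 1 \<in> ins w" using high[of "k + 1"] j jk1 k_odd le[of "k + 1" w 1] 2 k_ge by auto
      \<comment> \<open>Here the part before \<open>w\<close> takes the detour: \<open>k+2\<close>,
        then \<open>4..k+1\<close>, then \<open>w\<close>, then \<open>3\<close>. The end indices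
        \<open>k+2\<close> and \<open>3\<close> are both odd.\<close>
      moreover have "E (k + 2) 4" by (rule back_arc) (use k_ge k_odd in auto)
      moreover have "ipath (ivl (k + 2) (k + 2) @ ivl 4 (k + 1))"
        by (intro ipath_append ipath_ivl) (use k_ge \<open>E (k + 2) 4\<close> in \<open>auto simp: ivl_simps\<close>)
      ultimately show False
        by (intro thr[of "ivl (k + 2) (k + 2) @ ivl 4 (k + 1)" "ivl 3 3"] ipath_ivl)
          (use out i k_ge k_odd in \<open>auto simp: ivl_simps\<close>)
    qed
  qed
qed

text \<open>Here \<open>w\<close> receives arcs from its whole class and \<open>w'\<close> sends
  arcs to its whole class. An index at most \<open>1\<close> in the former and one at least
  \<open>k + 1\<close> in the latter give a three-step shortcut.\<close>

lemma no_ins_to_outs: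
  assumes "(w, w') \<in> A" "w \<notin> S" "w' \<notin> S" "outs w = {}" "nbs w \<noteq> {}" "ins w' = {}" "nbs w' \<noteq> {}"
  shows False
proof -
  obtain i where i: "i \<in> ins w" using assms(4,5) by (auto simp: nbs_def)
  obtain j where j: "j \<in> outs w'" using assms(6,7) by (auto simp: nbs_def)
  have "i mod 2 \<in> ins w" by (rule ins_full[OF i assms(2,4)]; use k_ge in presburger)
  moreover have "k + 1 + j mod 2 \<in> outs w'"
    by (rule outs_full[OF j assms(3,6)]; use k_odd in presburger)
  ultimately show False
    using ins_arc_outs_le[OF _ assms(1), of "i mod 2"] k_ge by fastforce
qed

text \<open>Prolong \<open>p\<close> around the cycle on \<open>P\<close> to \<open>k + 1\<close>
  vertices; the landing index is a neighbour of \<open>hd p\<close>. Its parity depends only on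
  \<open>i\<close> and \<open>length p\<close>, which is what later compares the classes of
  different vertices.\<close>

lemma extend_out:
  assumes "distinct p" "set p \<inter> S = {}" "arcwise A p" "p \<noteq> []" "length p \<le> k" "i \<in> outs (last p)"
  shows "\<exists>j\<in>nbs (hd p). odd (i + length p + j)"
proof -
  have len: "1 \<le> length p" using assms(4) by (cases p) auto
  obtain j where j: "linked i j (k + 1 - length p)" "j \<le> k + 2" "odd (i + (k + 1 - length p) + j)"
    by (rule linked_from[of i "k + 1 - length p"]) (use outs_le[OF assms(6)] assms(5) len in auto)
  have "adjacent A (hd (p @ [x i])) (last (x j # []))"
    by (rule bridge[OF _ _ assms(3) _ j(1)]) (use assms in auto)
  then have "j \<in> nbs (hd p)" using assms(4) j(2) by (simp add: nbs_iff)
  moreover have "odd (i + length p + j)" using j(3) assms(5) k_odd by presburger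
  ultimately show ?thesis by blast
qed

lemma extend_in:
  assumes "distinct p" "set p \<inter> S = {}" "arcwise A p" "p \<noteq> []" "length p \<le> k" "i \<in> ins (hd p)"
  shows "\<exists>j\<in>nbs (last p). odd (i + length p + j)"
proof -
  have len: "1 \<le> length p" using assms(4) by (cases p) auto
  obtain j where j: "linked j i (k + 1 - length p)" "j \<le> k + 2" "odd (j + (k + 1 - length p) + i)"
    by (rule linked_to[of i "k + 1 - length p"]) (use ins_le[OF assms(6)] assms(5) len in auto)
  have "adjacent A (hd ([] @ [x j])) (last (x i # p))"
    by (rule bridge[OF _ _ _ assms(3) j(1)]) (use assms in auto)
  then have "j \<in> nbs (last p)" using assms(4) j(2) by (simp add: nbs_iff adjacent_commute)
  moreover have "odd (i + length p + j)" using j(3) assms(5) k_odd by presburger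
  ultimately show ?thesis by blast
qed

section \<open>Distance to the geodesic\<close>

definition lev :: "'a \<Rightarrow> nat" where
  "lev w = (LEAST n. \<exists>i\<le>k+2. (w, x i) \<in> A ^^ n)"

lemma lev_ex:
  assumes "w \<in> V"
  shows "\<exists>i\<le>k+2. (w, x i) \<in> A ^^ lev w"
proof -
  have "x 0 \<in> V" using x_V by auto
  then obtain n where "(w, x 0) \<in> A ^^ n" using conn[OF assms] rtrancl_imp_relpow by blast
  then have "\<exists>n. \<exists>i\<le>k+2. (w, x i) \<in> A ^^ n" by blast
  then show ?thesis unfolding lev_def by (rule LeastI_ex)
qed

lemma lev_le: "(w, x i) \<in> A ^^ n \<Longrightarrow> i \<le> k + 2 \<Longrightarrow> lev w \<le> n"
  unfolding lev_def by (rule Least_le) blast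

lemma arc_V: "(w, w') \<in> A \<Longrightarrow> w \<in> V \<and> w' \<in> V"
  using arcs_V by blast

lemma lev_arc:
  assumes "(w, w') \<in> A"
  shows "lev w \<le> Suc (lev w')"
proof -
  obtain i where "i \<le> k + 2" "(w', x i) \<in> A ^^ lev w'" using lev_ex arc_V[OF assms] by blast
  then show ?thesis using lev_le relpow_Suc_I2[OF assms] by blast
qed

lemma lev_0_iff:
  assumes "w \<in> V"
  shows "lev w = 0 \<longleftrightarrow> w \<in> S"
proof
  assume "lev w = 0"
  then show "w \<in> S" using lev_ex[OF assms] by auto
next
  assume "w \<in> S"
  then obtain i where "i \<le> k + 2" "w = x i" by auto
  then show "lev w = 0" using lev_le[of w i 0] by simp
qed

lemma lev_Suc:
  assumes "w \<in> V" "lev w = Suc n"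
  shows "\<exists>w'. (w, w') \<in> A \<and> lev w' = n"
proof -
  obtain i where i: "i \<le> k + 2" "(w, x i) \<in> A ^^ Suc n" using lev_ex[OF assms(1)] assms(2) by auto
  then obtain w' where w': "(w, w') \<in> A" "(w', x i) \<in> A ^^ n" by (meson relpow_Suc_D2)
  have "lev w' \<le> n" using lev_le[OF w'(2) i(1)] .
  moreover have "Suc n \<le> Suc (lev w')" using lev_arc[OF w'(1)] assms(2) by simp
  ultimately show ?thesis using w'(1) by (intro exI[of _ w']) simp
qed

lemma outs_nonempty_iff:
  assumes "w \<in> V" "w \<notin> S"
  shows "outs w \<noteq> {} \<longleftrightarrow> lev w = 1"
proof
  assume "outs w \<noteq> {}"
  then obtain i where "i \<le> k + 2" "(w, x i) \<in> A" by (auto simp: outs_def)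
  then have "lev w \<le> 1" using lev_le[of w i 1] by simp
  moreover have "lev w \<noteq> 0" using lev_0_iff assms by simp
  ultimately show "lev w = 1" by simp
next
  assume "lev w = 1"
  then obtain w' where w': "(w, w') \<in> A" "lev w' = 0" using lev_Suc[OF assms(1), of 0] by auto
  then have "w' \<in> S" using lev_0_iff arc_V by blast
  then show "outs w \<noteq> {}" using w'(1) by (auto simp: outs_def)
qed

text \<open>The first \<open>m + 1\<close> vertices of a shortest walk from \<open>w\<close> to
  \<open>P\<close>. Since the levels strictly decrease while \<open>m \<le> lev w\<close>,
  distinctness need not be required, and for \<open>m < lev w\<close> the list avoids
  \<open>P\<close>.\<close>

definition descent :: "'a \<Rightarrow> nat \<Rightarrow> 'a list \<Rightarrow> bool" where
  "descent w m p \<longleftrightarrow> hd p = w \<and> length p = Suc m \<and> arcwise A p \<and> set p \<subseteq> V \<and>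
     (\<forall>t\<le>m. lev (p ! t) = lev w - t)"

lemma descent_ex:
  assumes "w \<in> V" "m \<le> lev w"
  shows "\<exists>p. descent w m p"
  using assms
proof (induction m arbitrary: w)
  case 0
  then show ?case by (intro exI[of _ "[w]"]) (simp add: descent_def)
next
  case (Suc m)
  then obtain n where n: "lev w = Suc n" "m \<le> n" by (metis Suc_le_D Suc_le_mono)
  obtain w' where w': "(w, w') \<in> A" "lev w' = n" using lev_Suc[OF Suc.prems(1) n(1)] by blast
  obtain p where p: "descent w' m p" using Suc.IH[of w'] arc_V[OF w'(1)] w'(2) n(2) by blast
  have "lev ((w # p) ! t) = lev w - t" if "t \<le> Suc m" for t
    using p that w'(2) n(1) by (cases t) (auto simp: descent_def)
  then have "descent w (Suc m) (w # p)"
    using p w'(1) Suc.prems(1) by (auto simp: descent_def successively_Cons)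
  then show ?case by blast
qed

lemma descent_hd: "descent w m p \<Longrightarrow> hd p = w"
  and descent_length: "descent w m p \<Longrightarrow> length p = Suc m"
  and descent_arcwise: "descent w m p \<Longrightarrow> arcwise A p"
  and descent_V: "descent w m p \<Longrightarrow> set p \<subseteq> V"
  and descent_nth: "descent w m p \<Longrightarrow> t \<le> m \<Longrightarrow> lev (p ! t) = lev w - t"
  by (auto simp: descent_def)

lemma descent_nonempty: "descent w m p \<Longrightarrow> p \<noteq> []"
  using descent_length by fastforce

lemma descent_last: "descent w m p \<Longrightarrow> last p = p ! m"
  using descent_length descent_nonempty by (metis diff_Suc_1 last_conv_nth)

lemma descent_0: "descent w m p \<Longrightarrow> p ! 0 = w"
  using descent_hd descent_nonempty by (metis hd_conv_nth)

lemma descent_lev_last: "descent w m p \<Longrightarrow> lev (last p) = lev w - m"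
  using descent_last[of w m p] descent_nth[of w m p m] by simp

lemma descent_distinct:
  assumes "descent w m p" "m \<le> lev w"
  shows "distinct p"
proof -
  have "p ! s \<noteq> p ! t" if st: "s < t" "t \<le> m" for s t
    using descent_nth[OF assms(1), of s] descent_nth[OF assms(1), of t] st assms(2) by auto
  then have "p ! s \<noteq> p ! t" if "s < length p" "t < length p" "s \<noteq> t" for s t
    using that descent_length[OF assms(1)] by (cases s t rule: linorder_cases) force+
  then show ?thesis unfolding distinct_conv_nth by blast
qed

lemma descent_outside:
  assumes "descent w m p" "m < lev w"
  shows "set p \<inter> S = {}"
proof -
  have "v \<notin> S" if "v \<in> set p" for v
  proof -
    obtain t where t: "t < length p" "v = p ! t"
      using \<open>v \<in> set p\<close> by (auto simp: in_set_conv_nth)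
    then have "t \<le> m" using descent_length[OF assms(1)] by simp
    then have "lev v \<noteq> 0" using descent_nth[OF assms(1)] assms(2) t(2) by simp
    have "v \<in> V" using \<open>v \<in> set p\<close> descent_V[OF assms(1)] by blast
    then show ?thesis using lev_0_iff \<open>lev v \<noteq> 0\<close> by metis
  qed
  then show ?thesis by blast
qed

lemma descent_step:
  assumes "descent w m p" "t < m"
  shows "(p ! t, p ! Suc t) \<in> A"
  using successively_nth[OF descent_arcwise[OF assms(1)]] descent_length[OF assms(1)] assms(2) by simp

lemma descent_in_set: "descent w m p \<Longrightarrow> t \<le> m \<Longrightarrow> p ! t \<in> set p"
  using descent_length by (metis le_imp_less_Suc nth_mem)

text \<open>Induction on the distance to \<open>P\<close>. A near vertex descends to level
  \<open>1\<close> and \<open>extend_out\<close> applies. A far one has a descent of length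
  \<open>k\<close>, whose last vertex \<open>y\<close> must send an arc back to it, and the
  neighbours of \<open>y\<close> are known by induction.\<close>

lemma nbs_nonempty:
  assumes "w \<in> V" "w \<notin> S"
  shows "nbs w \<noteq> {}"
  using assms
proof (induction "lev w" arbitrary: w rule: less_induct)
  case less
  have pos: "lev w \<noteq> 0" using lev_0_iff less.prems by simp
  show ?case
  proof (cases "lev w \<le> k")
    case True
    obtain p where p: "descent w (lev w - 1) p" using descent_ex[of w "lev w - 1"] less.prems by auto
    have lt: "lev w - 1 < lev w" using pos by simp
    have out: "set p \<inter> S = {}" by (rule descent_outside[OF p lt])
    have lastp: "last p \<in> set p" using descent_nonempty[OF p] by simp
    have "lev (last p) = 1" using descent_lev_last[OF p] pos by simp
    then have "outs (last p) \<noteq> {}"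
      using outs_nonempty_iff[of "last p"] lastp out descent_V[OF p] by blast
    then obtain i where "i \<in> outs (last p)" by blast
    then have "\<exists>j\<in>nbs (hd p). odd (i + length p + j)"
      using True pos
      by (intro extend_out out descent_distinct[OF p] descent_arcwise[OF p] descent_nonempty[OF p])
         (auto simp: descent_length[OF p])
    then show ?thesis using descent_hd[OF p] by auto
  next
    case False
    then have big: "k < lev w" by simp
    obtain p where p: "descent w k p" using descent_ex[of w k] less.prems big by auto
    define y where "y = last p"
    have out: "set p \<inter> S = {}" by (rule descent_outside[OF p big])
    have yp: "y \<in> set p" using descent_nonempty[OF p] by (simp add: y_def)
    have y: "y \<in> V" "y \<notin> S" using yp out descent_V[OF p] by auto
    have levy: "lev y = lev w - k" using descent_lev_last[OF p] by (simp add: y_def)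
    have "adjacent A (hd p) (last p)"
      by (rule kqt) (use descent_distinct[OF p] descent_arcwise[OF p] descent_length[OF p] big in auto)
    then have "adjacent A w y" by (simp add: y_def descent_hd[OF p])
    moreover have "(w, y) \<notin> A" using lev_arc[of w y] levy big k_ge by auto
    ultimately have yw: "(y, w) \<in> A" by (simp add: adjacent_def)
    have nby: "nbs y \<noteq> {}" by (rule less.hyps[OF _ y]) (use levy big k_ge in auto)
    show ?thesis
    proof (cases "ins y = {}")
      case False
      then obtain j where j: "j \<in> ins y" by blast
      have "\<exists>a\<in>nbs (last [y, w]). odd (j + length [y, w] + a)"
        by (rule extend_in) (use j yw y less.prems loopfree[of y] k_ge in auto)
      then show ?thesis by auto
    next
      case True
      \<comment> \<open>Now \<open>y\<close> only sends arcs to \<open>P\<close>, so it has level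
        \<open>1\<close>; its predecessor \<open>z\<close> on the descent has level \<open>2\<close>
        and only receives, which \<open>no_ins_to_outs\<close> forbids.\<close>
      then have "outs y \<noteq> {}" using nby by (simp add: nbs_def)
      then have levw: "lev w = k + 1" using outs_nonempty_iff[OF y] levy by simp
      define z where "z = p ! (k - 1)"
      have zp: "z \<in> set p" unfolding z_def by (rule descent_in_set[OF p]) simp
      have z: "z \<in> V" "z \<notin> S" using zp out descent_V[OF p] by auto
      have levz: "lev z = 2" using descent_nth[OF p, of "k - 1"] levw k_ge by (simp add: z_def)
      have "outs z = {}" using outs_nonempty_iff[OF z] levz by auto
      moreover have "(z, y) \<in> A"
        using descent_step[OF p, of "k - 1"] k_ge by (simp add: z_def y_def descent_last[OF p])
      moreover have "nbs z \<noteq> {}" by (rule less.hyps[OF _ z]) (use levz levw k_ge in auto)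
      ultimately show ?thesis using no_ins_to_outs[of z y] z y True nby by blast
    qed
  qed
qed

section \<open>Classes of the outer vertices\<close>

text \<open>Only an out- and an in-neighbour are directly comparable; two neighbours of the same
  kind are compared through one of the other kind.\<close>

lemma same_class_mixed:
  assumes "w \<notin> S" "outs w \<noteq> {}" "ins w \<noteq> {}" "i \<in> nbs w" "j \<in> nbs w"
  shows "d = 1 \<or> even (i + j)"
proof -
  obtain a b where ab: "a \<in> outs w" "b \<in> ins w" using assms(2,3) by blast
  have "d = 1 \<or> even (l + b)" if "l \<in> nbs w" for l
  proof (cases "l \<in> outs w")
    case True
    then show ?thesis using outs_ins_same_class ab(2) assms(1) by blast
  next
    case False
    then have "l \<in> ins w" using that by (simp add: nbs_def)
    then have "d = 1 \<or> even (a + l)" "d = 1 \<or> even (a + b)"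
      using outs_ins_same_class[OF ab(1) _ assms(1)] ab(2) by blast+
    then show ?thesis by presburger
  qed
  from this[OF assms(4)] this[OF assms(5)] show ?thesis by presburger
qed

text \<open>If both classes occurred, every vertex of \<open>P\<close> would send an arc to
  \<open>w\<close>. The next vertex \<open>w1\<close> towards \<open>P\<close> would then inherit
  both classes through paths \<open>x a\<close>, \<open>w\<close>, \<open>w1\<close>, against
  induction or the mixed case.\<close>

lemma same_class_ins:
  assumes "w \<in> V" "w \<notin> S" "outs w = {}" "i \<in> nbs w" "j \<in> nbs w"
  shows "d = 1 \<or> even (i + j)"
  using assms
proof (induction "lev w" arbitrary: w i j rule: less_induct)
  case less
  show ?case
  proof (rule ccontr)
    assume "\<not> ?thesis"
    then have d2: "d \<noteq> 1" and ij: "odd (i + j)" by auto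
    have i: "i \<in> ins w" and j: "j \<in> ins w" using less.prems by (auto simp: nbs_def)
    have all: "l \<in> ins w" if "l \<le> k + 2" for l
    proof (cases "even (i + l)")
      case True
      then show ?thesis using ins_full[OF i less.prems(2,3) that] by blast
    next
      case False
      then have "even (j + l)" using ij by presburger
      then show ?thesis using ins_full[OF j less.prems(2,3) that] by blast
    qed
    have lev: "lev w \<noteq> 0" "lev w \<noteq> 1"
      using lev_0_iff[OF less.prems(1)] outs_nonempty_iff[OF less.prems(1,2)] less.prems(2,3)
      by auto
    then obtain n where n: "lev w = Suc n" "n \<noteq> 0" by (metis One_nat_def not0_implies_Suc)
    obtain w1 where w1: "(w, w1) \<in> A" "lev w1 = n" using lev_Suc[OF less.prems(1) n(1)] by blast
    have w1V: "w1 \<in> V" using arc_V[OF w1(1)] by blast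
    have w1S: "w1 \<notin> S" using lev_0_iff[OF w1V] w1(2) n(2) by metis
    have ext: "\<exists>b\<in>nbs w1. odd (a + b)" if "a \<le> k + 2" for a
    proof -
      have "\<exists>b\<in>nbs (last [w, w1]). odd (a + length [w, w1] + b)"
        by (rule extend_in) (use all[OF that] w1 w1S less.prems(2) loopfree[of w] k_ge in auto)
      then show ?thesis by auto
    qed
    obtain b where b: "b \<in> nbs w1" "odd (0 + b)" using ext[of 0] by auto
    obtain c where c: "c \<in> nbs w1" "odd (1 + c)" using ext[of 1] by auto
    have bc: "odd (b + c)" using b(2) c(2) by presburger
    have "outs w1 \<noteq> {}" using less.hyps[OF _ w1V w1S _ b(1) c(1)] w1(2) n(1) bc d2 by auto
    moreover have "ins w1 \<noteq> {}"
      using no_ins_to_outs[OF w1(1) less.prems(2) w1S less.prems(3)] less.prems(4) b(1) by blast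
    ultimately show False using same_class_mixed[OF w1S _ _ b(1) c(1)] bc d2 by blast
  qed
qed

lemma same_class_outs:
  assumes "w \<in> V" "w \<notin> S" "ins w = {}" "i \<in> nbs w" "j \<in> nbs w"
  shows "d = 1 \<or> even (i + j)"
proof -
  interpret rv: kqt_geodesic_mod "A\<inverse>" k "\<lambda>i. x (k + 2 - i)" d V by (rule reverse)
  have le: "i \<le> k + 2" "j \<le> k + 2" using assms(4,5) by (auto simp: nbs_iff)
  have sub: "nbs w \<subseteq> {..k+2}" by (auto simp: nbs_iff)
  have "d = 1 \<or> even ((k + 2 - i) + (k + 2 - j))"
  proof (rule rv.same_class_ins[of w])
    show "w \<notin> rv.S" unfolding rev_S by (rule assms(2))
    show "rv.outs w = {}" unfolding rev_outs_empty by (rule assms(3))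
    show "k + 2 - i \<in> rv.nbs w" unfolding rev_nbs by (rule rev_mem[OF assms(4) sub])
    show "k + 2 - j \<in> rv.nbs w" unfolding rev_nbs by (rule rev_mem[OF assms(5) sub])
  qed (rule assms(1))
  then show ?thesis using le by presburger
qed

lemma same_class:
  assumes "w \<in> V" "w \<notin> S" "i \<in> nbs w" "j \<in> nbs w"
  shows "d = 1 \<or> even (i + j)"
  using same_class_mixed[OF assms(2)] same_class_ins[OF assms(1,2)] same_class_outs[OF assms(1,2)]
    assms(3,4) by blast

text \<open>The two-vertex outer path \<open>w\<close>, \<open>w'\<close> followed by
  \<open>x l\<close> gives \<open>w\<close> a neighbour of parity opposite to \<open>l\<close>,
  whereas \<open>l\<close> lies in the class of \<open>w'\<close>.\<close>

lemma cross_out: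
  assumes "(w, w') \<in> A" "w \<notin> S" "w' \<notin> S" "outs w' \<noteq> {}" "i \<in> nbs w" "j \<in> nbs w'"
  shows "d = 1 \<or> odd (i + j)"
proof -
  have V: "w \<in> V" "w' \<in> V" using arc_V[OF assms(1)] by auto
  obtain l where l: "l \<in> outs w'" using assms(4) by blast
  have "\<exists>b\<in>nbs (hd [w, w']). odd (l + length [w, w'] + b)"
    by (rule extend_out) (use l assms loopfree[of w] k_ge in auto)
  then obtain b where b: "b \<in> nbs w" "odd (l + 2 + b)" by auto
  have "l \<in> nbs w'" using l by (simp add: nbs_def)
  then have "d = 1 \<or> even (l + j)" using same_class V(2) assms(3,6) by blast
  moreover have "d = 1 \<or> even (b + i)" using same_class V(1) assms(2,5) b(1) by blast
  ultimately show ?thesis using b(2) by presburger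
qed

lemma cross_in:
  assumes "(w, w') \<in> A" "w \<notin> S" "w' \<notin> S" "ins w \<noteq> {}" "i \<in> nbs w" "j \<in> nbs w'"
  shows "d = 1 \<or> odd (i + j)"
proof -
  have V: "w \<in> V" "w' \<in> V" using arc_V[OF assms(1)] by auto
  obtain l where l: "l \<in> ins w" using assms(4) by blast
  have "\<exists>b\<in>nbs (last [w, w']). odd (l + length [w, w'] + b)"
    by (rule extend_in) (use l assms loopfree[of w] k_ge in auto)
  then obtain b where b: "b \<in> nbs w'" "odd (l + 2 + b)" by auto
  have "l \<in> nbs w" using l by (simp add: nbs_def)
  then have "d = 1 \<or> even (l + i)" using same_class V(1) assms(2,5) by blast
  moreover have "d = 1 \<or> even (b + j)" using same_class V(2) assms(3,6) b(1) by blast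
  ultimately show ?thesis using b(2) by presburger
qed

lemma outside_if_lev: "w \<in> V \<Longrightarrow> lev w \<noteq> 0 \<Longrightarrow> w \<notin> S"
  using lev_0_iff by metis

lemma outs_empty_if_lev: "w \<in> V \<Longrightarrow> 2 \<le> lev w \<Longrightarrow> outs w = {}"
  using outs_nonempty_iff[of w] outside_if_lev[of w] by fastforce

text \<open>Every vertex before the last has level at least \<open>2\<close>, hence receives an arc
  from \<open>P\<close>, so \<open>cross_in\<close> applies to each step.\<close>

lemma descent_alternates:
  assumes p: "descent w m p" "m < lev w" and "i \<in> nbs w" "t \<le> m" "a \<in> nbs (p ! t)"
  shows "d = 1 \<or> even (i + t + a)"
  using assms(4,5)
proof (induction t arbitrary: a)
  case 0
  have "w \<in> V" using descent_V[OF p(1)] descent_in_set[OF p(1), of 0] descent_0[OF p(1)] by auto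
  then show ?case
    using same_class[of w i a] outside_if_lev[of w] p(2) assms(3) 0(2) descent_0[OF p(1)] by simp
next
  case (Suc t)
  let ?v = "p ! t" and ?v' = "p ! Suc t"
  have V: "?v \<in> V" "?v' \<in> V"
    using descent_V[OF p(1)] descent_in_set[OF p(1)] Suc.prems(1) by (meson Suc_leD subsetD)+
  have lev: "lev ?v = lev w - t" "lev ?v' = lev w - Suc t"
    using descent_nth[OF p(1)] Suc.prems(1) by auto
  have S: "?v \<notin> S" "?v' \<notin> S"
    using outside_if_lev[OF V(1)] outside_if_lev[OF V(2)] lev Suc.prems(1) p(2) by auto
  have "outs ?v = {}" using outs_empty_if_lev[OF V(1)] lev(1) Suc.prems(1) p(2) by auto
  moreover obtain b where b: "b \<in> nbs ?v" using nbs_nonempty[OF V(1) S(1)] by blast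
  ultimately have "ins ?v \<noteq> {}" by (auto simp: nbs_def)
  then have "d = 1 \<or> odd (b + a)"
    using cross_in[OF _ S _ b Suc.prems(2)] descent_step[OF p(1), of t] Suc.prems(1) by simp
  moreover have "d = 1 \<or> even (i + t + b)" using Suc.IH[OF _ b] Suc.prems(1) by simp
  ultimately show ?case by presburger
qed

text \<open>What \<open>cross_out\<close> and \<open>cross_in\<close> leave open is an arc from a
  vertex that only sends to one that only receives. Induction on the distance of \<open>w'\<close>
  to \<open>P\<close> compares both classes along a descent from \<open>w'\<close>.\<close>

lemma cross:
  assumes "(w, w') \<in> A" "w \<notin> S" "w' \<notin> S" "i \<in> nbs w" "j \<in> nbs w'"
  shows "d = 1 \<or> odd (i + j)"
  using assms
proof (induction "lev w'" arbitrary: w' j rule: less_induct)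
  case less
  have V: "w \<in> V" "w' \<in> V" using arc_V[OF less.prems(1)] by auto
  show ?case
  proof (cases "outs w' \<noteq> {} \<or> ins w \<noteq> {}")
    case True
    then show ?thesis using cross_out[OF less.prems(1-3) _ less.prems(4,5)]
      cross_in[OF less.prems(1-3) _ less.prems(4,5)] by blast
  next
    case False
    then have e: "outs w' = {}" "ins w = {}" by auto
    then have outw: "outs w \<noteq> {}" using less.prems(4) by (auto simp: nbs_def)
    then have levw: "lev w = 1" using outs_nonempty_iff[OF V(1) less.prems(2)] by simp
    have lev2: "2 \<le> lev w'"
      using outs_nonempty_iff[OF V(2) less.prems(3)] e(1) lev_0_iff[OF V(2)] less.prems(3)
      by (metis One_nat_def Suc_1 Suc_leI less_Suc0 less_one linorder_neqE_nat not_less_eq)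
    \<comment> \<open>As \<open>w\<close> has level \<open>1\<close>, on the descent it would follow
      a vertex of level \<open>2\<close>, which only receives; \<open>no_ins_to_outs\<close>
      excludes that arc.\<close>
    have fresh: "w \<notin> set p" if p: "descent w' m p" and m: "m < lev w'" for m p
    proof
      assume "w \<in> set p"
      then obtain t where t: "t < length p" "p ! t = w" by (auto simp: in_set_conv_nth)
      then have tm: "t \<le> m" using descent_length[OF p] by simp
      have "lev w' - t = 1" using descent_nth[OF p tm] t(2) levw by simp
      then obtain s where s: "t = Suc s" "lev w' - s = 2" using lev2 by (cases t) auto
      let ?v = "p ! s"
      have v: "?v \<in> V" using descent_V[OF p] descent_in_set[OF p, of s] tm s(1) by auto
      have levv: "lev ?v = 2" using descent_nth[OF p, of s] tm s by simp
      have vS: "?v \<notin> S" using outside_if_lev[OF v] levv by simp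
      have "(?v, w) \<in> A" using descent_step[OF p, of s] tm s(1) t(2) by simp
      then show False
        using no_ins_to_outs[of ?v w] vS less.prems(2) outs_empty_if_lev[OF v] levv e(2)
          nbs_nonempty[OF v vS] less.prems(4) by auto
    qed
    show ?thesis
    proof (rule ccontr)
      assume "\<not> ?thesis"
      then have d2: "d \<noteq> 1" and ij: "even (i + j)" by auto
      show False
      proof (cases "lev w' \<le> k - 1")
        case True
        define n where "n = lev w'"
        obtain p where p: "descent w' (n - 1) p"
          using descent_ex[of w' "n - 1"] V(2) by (auto simp: n_def)
        have lt: "n - 1 < lev w'" using lev2 by (simp add: n_def)
        have len: "length p = n" using descent_length[OF p] lev2 by (simp add: n_def)
        note pp = descent_distinct[OF p less_imp_le[OF lt]] descent_outside[OF p lt]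
          descent_arcwise[OF p] descent_nonempty[OF p]
        have "last p \<in> set p" using pp(4) by simp
        then have lastp: "last p \<in> V" "last p \<notin> S" using pp(2) descent_V[OF p] by blast+
        have "lev (last p) = 1" using descent_lev_last[OF p] lev2 by (simp add: n_def)
        then have "outs (last p) \<noteq> {}" using outs_nonempty_iff[OF lastp] by simp
        then obtain l where l: "l \<in> outs (last p)" by blast
        \<comment> \<open>The paths \<open>p\<close> and \<open>w # p\<close> leave through the same
          \<open>x l\<close> and differ by one in length, so their heads get neighbours of opposite
          parity.\<close>
        have "\<exists>b\<in>nbs (hd p). odd (l + length p + b)"
          by (rule extend_out[OF pp _ l]) (use len True in \<open>simp add: n_def\<close>)
        then obtain b where b: "b \<in> nbs w'" "odd (l + n + b)" using len descent_hd[OF p] by auto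
        have "\<exists>c\<in>nbs (hd (w # p)). odd (l + length (w # p) + c)"
        proof (rule extend_out)
          show "distinct (w # p)" using pp(1) fresh[OF p lt] by simp
          show "set (w # p) \<inter> S = {}" using pp(2) less.prems(2) by auto
          show "arcwise A (w # p)" using pp(3) less.prems(1) descent_hd[OF p] by (simp add: successively_Cons)
          show "length (w # p) \<le> k" using len True k_ge by (simp add: n_def)
          show "l \<in> outs (last (w # p))" using l pp(4) by simp
        qed simp
        then obtain c where c: "c \<in> nbs w" "odd (l + Suc n + c)" using len by auto
        have "even (b + j)" using same_class[OF V(2) less.prems(3) b(1) less.prems(5)] d2 by simp
        moreover have "even (c + i)" using same_class[OF V(1) less.prems(2) c(1) less.prems(4)] d2 by simp
        ultimately show False using b(2) c(2) ij by presburger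
      next
        case False
        then have big: "k - 1 < lev w'" by simp
        obtain p where p: "descent w' (k - 1) p"
          using descent_ex[of w' "k - 1"] V(2) big by auto
        define y where "y = last p"
        note pp = descent_distinct[OF p less_imp_le[OF big]] descent_outside[OF p big]
          descent_arcwise[OF p] descent_nonempty[OF p]
        have "y \<in> set p" using pp(4) by (simp add: y_def)
        then have y: "y \<in> V" "y \<notin> S" using pp(2) descent_V[OF p] by blast+
        have levy: "lev y < lev w'" using descent_lev_last[OF p] big k_ge by (simp add: y_def)
        \<comment> \<open>Now \<open>w\<close> followed by \<open>k\<close> descent vertices has
          length \<open>k\<close>, so \<open>w\<close> and \<open>y\<close> are adjacent. Since
          \<open>k - 1\<close> is even, \<open>y\<close> has the class of \<open>w'\<close>, and it
          is closer to \<open>P\<close>.\<close>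
        have "adjacent A (hd (w # p)) (last (w # p))"
        proof (rule kqt)
          show "distinct (w # p)" using pp(1) fresh[OF p big] by simp
          show "arcwise A (w # p)" using pp(3) less.prems(1) descent_hd[OF p] by (simp add: successively_Cons)
          show "length (w # p) = k + 1" using descent_length[OF p] k_ge by simp
        qed
        then have adj: "(w, y) \<in> A \<or> (y, w) \<in> A" using pp(4) by (simp add: y_def adjacent_def)
        obtain a where a: "a \<in> nbs y" using nbs_nonempty[OF y] by blast
        have "even (j + (k - 1) + a)"
          using descent_alternates[OF p big less.prems(5) order.refl] a d2
          by (simp add: y_def descent_last[OF p])
        then have ja: "even (j + a)" using k_odd k_ge by simp
        from adj have "odd (i + a)"
        proof
          assume "(w, y) \<in> A"
          then show ?thesis using less.hyps[OF levy _ less.prems(2) y(2) less.prems(4) a] d2 by simp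
        next
          assume "(y, w) \<in> A"
          then show ?thesis using cross_out[OF _ y(2) less.prems(2) outw a less.prems(4)] d2
            by (simp add: add.commute)
        qed
        then show False using ja ij by presburger
      qed
    qed
  qed
qed

section \<open>Adjacency of opposite classes\<close>

lemma adjacent_if_linked:
  assumes "w \<notin> S" "w' \<notin> S" "w \<noteq> w'" "i \<in> outs w" "j \<in> ins w'" "linked i j (k - 1)"
  shows "adjacent A w w'"
  using bridge[of "[w]" "[w']" i j "k - 1"] assms k_ge by simp

text \<open>From an in-neighbour \<open>b\<close> of \<open>w'\<close> go back \<open>k - 1\<close>
  vertices to \<open>a\<close>. Parity puts \<open>a\<close> in the class of \<open>w\<close>, and
  \<open>w\<close> sends arcs to all of its class.\<close>

lemma adjacent_outs_only:
  assumes "w \<in> V" "w \<notin> S" "w' \<in> V" "w' \<notin> S" "w \<noteq> w'" "ins w = {}" "ins w' \<noteq> {}"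
    and "i \<in> nbs w" "j \<in> nbs w'" "d = 1 \<or> odd (i + j)"
  shows "adjacent A w w'"
proof -
  obtain b where b: "b \<in> ins w'" using assms(7) by blast
  obtain a where a: "linked a b (k - 1)" "a \<le> k + 2" "odd (a + (k - 1) + b)"
    by (rule linked_to[of b "k - 1"]) (use ins_le[OF b] k_ge in auto)
  have "b \<in> nbs w'" using b by (simp add: nbs_def)
  then have "d = 1 \<or> even (b + j)" using same_class assms(3,4,9) by blast
  moreover have "odd (a + b)" using a(3) k_odd k_ge by simp
  ultimately have "d = 1 \<or> even (i + a)" using assms(10) by presburger
  moreover have "i \<in> outs w" using assms(6,8) by (simp add: nbs_def)
  ultimately have "a \<in> outs w" using outs_full assms(2,6) a(2) by blast
  then show ?thesis using adjacent_if_linked[OF assms(2,4,5) _ b a(1)] by blast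
qed

lemma adjacent_ins_only:
  assumes "w \<in> V" "w \<notin> S" "w' \<in> V" "w' \<notin> S" "w \<noteq> w'" "outs w = {}" "outs w' \<noteq> {}"
    and "i \<in> nbs w" "j \<in> nbs w'" "d = 1 \<or> odd (i + j)"
  shows "adjacent A w w'"
proof -
  obtain b where b: "b \<in> outs w'" using assms(7) by blast
  obtain a where a: "linked b a (k - 1)" "a \<le> k + 2" "odd (b + (k - 1) + a)"
    by (rule linked_from[of b "k - 1"]) (use outs_le[OF b] k_ge in auto)
  have "b \<in> nbs w'" using b by (simp add: nbs_def)
  then have "d = 1 \<or> even (b + j)" using same_class assms(3,4,9) by blast
  moreover have "odd (a + b)" using a(3) k_odd k_ge by (simp add: add.commute)
  ultimately have "d = 1 \<or> even (i + a)" using assms(10) by presburger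
  moreover have "i \<in> ins w" using assms(6,8) by (simp add: nbs_def)
  ultimately have "a \<in> ins w" using ins_full assms(2,6) a(2) by blast
  then have "adjacent A w' w"
    using adjacent_if_linked[OF assms(4,2) _ b _ a(1)] assms(5) by blast
  then show ?thesis by (simp add: adjacent_commute)
qed

text \<open>Neither vertex can enter \<open>P\<close> directly, so the nearer one descends to
  \<open>P\<close>, runs along it and leaves to \<open>w'\<close>, which accepts arcs from its whole
  class. If the descent is too long, its vertex \<open>y\<close> after \<open>k - 1\<close> steps
  takes the place of \<open>w\<close> in the induction.\<close>

lemma adjacent_both_ins_only_aux:
  assumes "w \<in> V" "w \<notin> S" "w' \<in> V" "w' \<notin> S" "w \<noteq> w'" "outs w = {}" "outs w' = {}"
    and "i \<in> nbs w" "j \<in> nbs w'" "d = 1 \<or> odd (i + j)" "lev w \<le> lev w'"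
  shows "adjacent A w w'"
  using assms
proof (induction "lev w" arbitrary: w i rule: less_induct)
  case less
  note V = less.prems(1,3) and S = less.prems(2,4) and ne = less.prems(5)
    and e = less.prems(6,7) and ij = less.prems(8,9,10) and le = less.prems(11)
  have lev2: "2 \<le> lev w"
    using outs_nonempty_iff[OF V(1) S(1)] e(1) lev_0_iff[OF V(1)] S(1)
    by (metis One_nat_def Suc_1 Suc_leI less_Suc0 less_one linorder_neqE_nat not_less_eq)
  have fresh: "w' \<notin> set p" if p: "descent w m p" and m: "m < lev w" for m p
  proof
    assume "w' \<in> set p"
    then obtain t where t: "t < length p" "p ! t = w'" by (auto simp: in_set_conv_nth)
    then have tm: "t \<le> m" using descent_length[OF p] by simp
    then have "lev w' = lev w - t" using descent_nth[OF p tm] t(2) by simp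
    then have "t = 0" using le lev2 by simp
    then show False using t(2) descent_0[OF p] ne by simp
  qed
  show ?case
  proof (cases "lev w \<le> k - 1")
    case True
    define n where "n = lev w"
    obtain p where p: "descent w (n - 1) p"
      using descent_ex[of w "n - 1"] V(1) by (auto simp: n_def)
    have lt: "n - 1 < lev w" using lev2 by (simp add: n_def)
    have len: "length p = n" using descent_length[OF p] lev2 by (simp add: n_def)
    note pp = descent_distinct[OF p less_imp_le[OF lt]] descent_outside[OF p lt]
      descent_arcwise[OF p] descent_nonempty[OF p]
    have "last p \<in> set p" using pp(4) by simp
    then have lastp: "last p \<in> V" "last p \<notin> S" using pp(2) descent_V[OF p] by blast+
    have "lev (last p) = 1" using descent_lev_last[OF p] lev2 by (simp add: n_def)
    then have "outs (last p) \<noteq> {}" using outs_nonempty_iff[OF lastp] by simp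
    then obtain l where l: "l \<in> outs (last p)" by blast
    have nk: "n \<le> k - 1" "1 \<le> n" using True lev2 by (auto simp: n_def)
    obtain b where b: "linked l b (k - n)" "b \<le> k + 2" "odd (l + (k - n) + b)"
      by (rule linked_from[of l "k - n"]) (use outs_le[OF l] nk k_ge in auto)
    have "\<exists>c\<in>nbs (hd p). odd (l + length p + c)"
      by (rule extend_out[OF pp _ l]) (use len nk in simp)
    then obtain c where c: "c \<in> nbs w" "odd (l + n + c)" using len descent_hd[OF p] by auto
    have "d = 1 \<or> even (c + i)" using same_class[OF V(1) S(1) c(1) ij(1)] .
    moreover have "odd (l + k + n + b)" using b(3) nk by presburger
    ultimately have "d = 1 \<or> even (j + b)" using c(2) ij(3) k_odd by presburger
    moreover have "j \<in> ins w'" using ij(2) e(2) by (simp add: nbs_def)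
    ultimately have bin: "b \<in> ins w'" using ins_full[OF _ S(2) e(2) b(2)] by blast
    have "adjacent A (hd (p @ [x l])) (last (x b # [w']))"
    proof (rule bridge[OF _ _ pp(3) _ b(1)])
      show "distinct (p @ [w'])" using pp(1) fresh[OF p lt] by simp
      show "set (p @ [w']) \<inter> S = {}" using pp(2) S(2) by auto
      show "length p + (k - n) + length [w'] = k + 1" using len nk k_ge by simp
    qed (use l bin in auto)
    then show ?thesis using pp(4) descent_hd[OF p] by simp
  next
    case False
    then have big: "k - 1 < lev w" by simp
    obtain p where p: "descent w (k - 1) p"
      using descent_ex[of w "k - 1"] V(1) big by auto
    define y where "y = last p"
    note pp = descent_distinct[OF p less_imp_le[OF big]] descent_outside[OF p big]
      descent_arcwise[OF p] descent_nonempty[OF p]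
    have "y \<in> set p" using pp(4) by (simp add: y_def)
    then have y: "y \<in> V" "y \<notin> S" using pp(2) descent_V[OF p] by blast+
    have levy: "lev y = lev w - (k - 1)" using descent_lev_last[OF p] by (simp add: y_def)
    have lt: "lev y + 1 < lev w" using levy big k_ge by simp
    obtain a where a: "a \<in> nbs y" using nbs_nonempty[OF y] by blast
    have "d = 1 \<or> even (i + (k - 1) + a)"
      using descent_alternates[OF p big ij(1) order.refl] a
      by (simp add: y_def descent_last[OF p])
    then have aj: "d = 1 \<or> odd (a + j)" using ij(3) k_odd by presburger
    have yw': "y \<noteq> w'" using lt le by auto
    have "adjacent A y w'"
    proof (cases "outs y = {}")
      case True
      show ?thesis by (rule less.hyps[OF _ y V(2) S(2) yw' True e(2) a ij(2) aj]) (use lt le in auto)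
    next
      case False
      have "adjacent A w' y"
        by (rule adjacent_ins_only[OF V(2) S(2) y _ e(2) False ij(2) a])
          (use yw' aj in \<open>auto simp: add.commute\<close>)
      then show ?thesis by (simp add: adjacent_commute)
    qed
    \<comment> \<open>Such an arc would lower the level by more than one. With the arc from
      \<open>y\<close> to \<open>w'\<close> instead, the descent followed by \<open>w'\<close> has
      length \<open>k\<close>.\<close>
    moreover have "(w', y) \<notin> A" using lev_arc[of w' y] lt le by auto
    ultimately have yw: "(y, w') \<in> A" by (simp add: adjacent_def)
    have "adjacent A (hd (p @ [w'])) (last (p @ [w']))"
    proof (rule kqt)
      show "distinct (p @ [w'])" using pp(1) fresh[OF p big] by simp
      show "arcwise A (p @ [w'])" using pp(3) yw by (simp add: successively_append_iff y_def)
      show "length (p @ [w']) = k + 1" using descent_length[OF p] k_ge by simp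
    qed
    then show ?thesis using pp(4) descent_hd[OF p] by simp
  qed
qed

lemma adjacent_both_ins_only:
  assumes "w \<in> V" "w \<notin> S" "w' \<in> V" "w' \<notin> S" "w \<noteq> w'" "outs w = {}" "outs w' = {}"
    and "i \<in> nbs w" "j \<in> nbs w'" "d = 1 \<or> odd (i + j)"
  shows "adjacent A w w'"
proof (cases "lev w \<le> lev w'")
  case True
  then show ?thesis using adjacent_both_ins_only_aux[OF assms] by blast
next
  case False
  have "d = 1 \<or> odd (j + i)" using assms(10) by (simp add: add.commute)
  then have "adjacent A w' w"
    using adjacent_both_ins_only_aux[OF assms(3,4,1,2) _ assms(7,6,9,8)] False assms(5) by auto
  then show ?thesis by (simp add: adjacent_commute)
qed

lemma adjacent_both_outs_only:
  assumes "w \<in> V" "w \<notin> S" "w' \<in> V" "w' \<notin> S" "w \<noteq> w'" "ins w = {}" "ins w' = {}"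
    and "i \<in> nbs w" "j \<in> nbs w'" "d = 1 \<or> odd (i + j)"
  shows "adjacent A w w'"
proof -
  interpret rv: kqt_geodesic_mod "A\<inverse>" k "\<lambda>i. x (k + 2 - i)" d V by (rule reverse)
  have le: "i \<le> k + 2" "j \<le> k + 2" using assms(8,9) by (auto simp: nbs_iff)
  have sub: "nbs v \<subseteq> {..k+2}" for v by (auto simp: nbs_iff)
  have "adjacent (A\<inverse>) w w'"
  proof (rule rv.adjacent_both_ins_only[OF assms(1) _ assms(3) _ assms(5)])
    show "w \<notin> rv.S" "w' \<notin> rv.S" unfolding rev_S by (rule assms(2,4))+
    show "rv.outs w = {}" "rv.outs w' = {}" unfolding rev_outs_empty by (rule assms(6,7))+
    show "k + 2 - i \<in> rv.nbs w" unfolding rev_nbs by (rule rev_mem[OF assms(8) sub])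
    show "k + 2 - j \<in> rv.nbs w'" unfolding rev_nbs by (rule rev_mem[OF assms(9) sub])
    show "d = 1 \<or> odd ((k + 2 - i) + (k + 2 - j))" using le assms(10) by presburger
  qed
  then show ?thesis by (simp add: adjacent_converse)
qed

text \<open>A putative nonadjacent pair of opposite classes, both vertices having arcs to and from \<open>P\<close>.
  Reversal swaps the roles of the two vertices, which is why the parities are fixed asymmetrically.\<close>

definition detached :: "'a \<Rightarrow> 'a \<Rightarrow> bool" where
  "detached w w' \<longleftrightarrow> w \<notin> S \<and> w' \<notin> S \<and> w \<noteq> w' \<and> \<not> adjacent A w w' \<and>
     outs w \<noteq> {} \<and> ins w \<noteq> {} \<and> outs w' \<noteq> {} \<and> ins w' \<noteq> {} \<and>
     (\<forall>i\<in>nbs w. d = 1 \<or> even i) \<and> (\<forall>i\<in>nbs w'. d = 1 \<or> odd i)"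

lemma rev_detached:
  assumes "detached w w'"
  shows "kqt_geodesic_mod.detached (A\<inverse>) k (\<lambda>i. x (k + 2 - i)) d w' w"
proof -
  interpret rv: kqt_geodesic_mod "A\<inverse>" k "\<lambda>i. x (k + 2 - i)" d V by (rule reverse)
  have "d = 1 \<or> odd i" if "i \<le> k + 2" "k + 2 - i \<in> nbs w" for i
  proof -
    have "d = 1 \<or> even (k + 2 - i)" using assms that(2) unfolding detached_def by blast
    then show ?thesis using that(1) k_odd by presburger
  qed
  moreover have "d = 1 \<or> even i" if "i \<le> k + 2" "k + 2 - i \<in> nbs w'" for i
  proof -
    have "d = 1 \<or> odd (k + 2 - i)" using assms that(2) unfolding detached_def by blast
    then show ?thesis using that(1) k_odd by presburger
  qed
  moreover have "\<not> adjacent A w' w" using assms by (simp add: detached_def adjacent_commute)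
  ultimately show ?thesis
    using assms unfolding rv.detached_def detached_def rev_S rev_outs_empty rev_ins_empty rev_nbs adjacent_converse
    by auto
qed

text \<open>In each excluded position \<open>P\<close> has a path of \<open>k - 1\<close> vertices
  from \<open>i\<close> to \<open>j\<close>: \<open>linked_k_minus_1\<close> if
  \<open>j < i\<close>, a plain segment if \<open>j = i + k - 2\<close>. Together with the two outer
  vertices it would have length \<open>k\<close>.\<close>

lemma detached_constraint:
  assumes "detached w w'"
  shows "i \<in> outs w \<Longrightarrow> j \<in> ins w' \<Longrightarrow> i \<le> j \<and> j \<noteq> i + k - 2"
    and "i \<in> outs w' \<Longrightarrow> j \<in> ins w \<Longrightarrow> i \<le> j \<and> j \<noteq> i + k - 2"
proof -
  have *: "i \<le> j \<and> j \<noteq> i + k - 2"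
    if v: "v \<notin> S" "v' \<notin> S" "v \<noteq> v'" "\<not> adjacent A v v'" "i \<in> outs v" "j \<in> ins v'"
      "d = 1 \<or> odd (i + j)" for v v'
  proof -
    have nl: "\<not> linked i j (k - 1)" using adjacent_if_linked[OF v(1-3,5,6)] v(4) by blast
    have "\<not> j < i" using linked_k_minus_1[OF _ outs_le[OF v(5)] v(7)] nl by blast
    moreover have "linked i j (k - 1)" if "j = i + k - 2"
      by (rule linked_ivl; use that ins_le[OF v(6)] k_ge in linarith)
    ultimately show ?thesis using nl by auto
  qed
  have w: "w \<notin> S" "w' \<notin> S" "w \<noteq> w'" "\<not> adjacent A w w'" "w' \<noteq> w" "\<not> adjacent A w' w"
    using assms adjacent_commute[of A w w'] unfolding detached_def by blast+
  have par: "d = 1 \<or> even a" if "a \<in> nbs w" for a using that assms unfolding detached_def by blast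
  have par': "d = 1 \<or> odd a" if "a \<in> nbs w'" for a using that assms unfolding detached_def by blast
  show "i \<le> j \<and> j \<noteq> i + k - 2" if "i \<in> outs w" "j \<in> ins w'"
    using *[OF w(1-4) that] par[of i] par'[of j] that by (auto simp: nbs_def)
  show "i \<le> j \<and> j \<noteq> i + k - 2" if "i \<in> outs w'" "j \<in> ins w"
    using *[OF w(2,1,5,6) that] par'[of i] par[of j] that by (auto simp: nbs_def)
qed

text \<open>Otherwise \<open>0\<close> is an in-neighbour of \<open>w\<close>, which forces every
  out-neighbour of \<open>w'\<close> to be \<open>0\<close>. By parity \<open>d = 1\<close>, and
  then \<open>k - 2\<close> is an in-neighbour of \<open>w\<close>, an excluded position.\<close>

lemma detached_outs_0:
  assumes "detached w w'"
  shows "0 \<in> outs w"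
proof (rule ccontr)
  assume no: "0 \<notin> outs w"
  have w: "w \<notin> S" using assms by (simp add: detached_def)
  obtain i where i: "i \<in> outs w" using assms by (auto simp: detached_def)
  have i0: "i \<noteq> 0" using i no by metis
  have "d = 1 \<or> even i" using assms i by (auto simp: detached_def nbs_def)
  then have "0 \<in> nbs w" using out_nbs[OF i w, of 0] i0 by auto
  then have in0: "0 \<in> ins w" using no by (simp add: nbs_def)
  obtain a where a: "a \<in> outs w'" using assms by (auto simp: detached_def)
  have "a = 0" using detached_constraint(2)[OF assms a in0] by simp
  moreover have "d = 1 \<or> odd a" using assms a by (auto simp: detached_def nbs_def)
  ultimately have "d = 1" by simp
  then have "k - 2 \<in> ins w" using ins_above[OF in0 w, of "k - 2"] k_ge by simp
  then show False using detached_constraint(2)[OF assms a] \<open>a = 0\<close> by fastforce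
qed

lemma detached_ins_last:
  assumes "detached w w'"
  shows "k + 2 \<in> ins w'"
proof -
  interpret rv: kqt_geodesic_mod "A\<inverse>" k "\<lambda>i. x (k + 2 - i)" d V by (rule reverse)
  show ?thesis using rv.detached_outs_0[OF rev_detached[OF assms]] unfolding rev_outs by simp
qed

text \<open>If \<open>k - 1\<close> were an out-neighbour of \<open>w\<close>, going down would
  reach \<open>4\<close>, which is excluded by \<open>4 + k - 2 = k + 2\<close>. Only
  \<open>k = 7\<close> escapes this argument, since from \<open>6\<close> to \<open>4\<close> the
  gap is too small for \<open>outs_below\<close>.\<close>

lemma detached_ins_k_minus_1:
  assumes "detached w w'"
  shows "k - 1 \<in> ins w"
proof (rule ccontr)
  assume no: "k - 1 \<notin> ins w"
  have S: "w \<notin> S" "w' \<notin> S" using assms by (auto simp: detached_def)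
  note c = detached_constraint[OF assms]
  have last: "k + 2 \<in> ins w'" by (rule detached_ins_last[OF assms])
  have "0 + k - 1 \<in> nbs w" by (rule out_nbs_wrap[OF detached_outs_0[OF assms] S(1)]) simp
  then have out: "k - 1 \<in> outs w" using no by (simp add: nbs_def)
  have no4: "4 \<notin> outs w" using c(1)[OF _ last, of 4] by auto
  have "k = 5 \<or> k = 7 \<or> 9 \<le> k" using k_odd k_ge by presburger
  then consider "k = 5" | "k = 7" | "9 \<le> k" by blast
  then show False
  proof cases
    case 1
    then show False using out no4 by simp
  next
    case 2
    have "4 \<in> nbs w" by (rule out_nbs[OF out S(1)]) (use 2 in auto)
    then have "4 \<in> ins w" using no4 by (simp add: nbs_def)
    then have "8 \<in> ins w" using ins_above[OF _ S(1), of 4 8] 2 by simp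
    \<comment> \<open>The excluded position is \<open>3 + k - 2 = 8\<close>. So \<open>3\<close> is
      an in-neighbour of \<open>w'\<close> while \<open>6\<close> is an out-neighbour of
      \<open>w\<close>, against the order constraint.\<close>
    then have no3: "3 \<notin> outs w'" using c(2)[of 3 8] 2 by auto
    have "k + 2 + 1 - k \<in> nbs w'" by (rule in_nbs_wrap[OF last S(2)]) simp
    then have "3 \<in> ins w'" using no3 by (simp add: nbs_def)
    then show False using c(1)[OF out] 2 by fastforce
  next
    case 3
    have "4 \<in> outs w" by (rule outs_below[OF out S(1)]) (use 3 k_odd in auto)
    then show False using no4 by simp
  qed
qed

lemma detached_outs_3:
  assumes "detached w w'"
  shows "3 \<in> outs w'"
proof -
  interpret rv: kqt_geodesic_mod "A\<inverse>" k "\<lambda>i. x (k + 2 - i)" d V by (rule reverse)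
  have "k + 2 - (k - 1) = 3" using k_ge by simp
  then show ?thesis using rv.detached_ins_k_minus_1[OF rev_detached[OF assms]] unfolding rev_ins by simp
qed

text \<open>Excluding positions \<open>1 + k - 2\<close> and \<open>3 + k - 2\<close> turns
  \<open>1\<close> into an in-neighbour of \<open>w'\<close> and \<open>k + 1\<close> into an
  out-neighbour of \<open>w\<close>, violating \<open>i \<le> j\<close>.\<close>

lemma not_detached: "\<not> detached w w'"
proof
  assume dt: "detached w w'"
  have S: "w \<notin> S" "w' \<notin> S" using dt by (auto simp: detached_def)
  note c = detached_constraint[OF dt]
  note k1 = detached_ins_k_minus_1[OF dt] and o3 = detached_outs_3[OF dt]
  have "1 \<in> nbs w'" by (rule out_nbs[OF o3 S(2)]) auto
  moreover have "1 \<notin> outs w'" using c(2)[OF _ k1, of 1] k_ge by auto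
  ultimately have in1: "1 \<in> ins w'" by (simp add: nbs_def)
  have "k + 1 \<in> nbs w" by (rule in_nbs[OF k1 S(1)]) (use k_odd k_ge in auto)
  moreover have "k + 1 \<notin> ins w" using c(2)[OF o3, of "k + 1"] k_ge by auto
  ultimately have "k + 1 \<in> outs w" by (simp add: nbs_def)
  then show False using c(1)[OF _ in1, of "k + 1"] k_ge by auto
qed

lemma adjacent_opposite:
  assumes "w \<in> V" "w \<notin> S" "w' \<in> V" "w' \<notin> S" "w \<noteq> w'"
    and "i \<in> nbs w" "j \<in> nbs w'" "d = 1 \<or> odd (i + j)"
  shows "adjacent A w w'"
proof -
  have sym: "adjacent A w w' = adjacent A w' w" by (rule adjacent_commute)
  have ji: "d = 1 \<or> odd (j + i)" using assms(8) by (simp add: add.commute)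
  have ne: "nbs w \<noteq> {}" "nbs w' \<noteq> {}" using assms(6,7) by auto
  consider "outs w = {}" | "outs w' = {}" "outs w \<noteq> {}" | "ins w = {}" | "ins w' = {}" "ins w \<noteq> {}"
    | "outs w \<noteq> {}" "ins w \<noteq> {}" "outs w' \<noteq> {}" "ins w' \<noteq> {}" by blast
  then show ?thesis
  proof cases
    case 1
    then show ?thesis
      using adjacent_both_ins_only[OF assms(1-5) _ _ assms(6-8)]
        adjacent_ins_only[OF assms(1-5) _ _ assms(6-8)] by blast
  next
    case 2
    then show ?thesis unfolding sym
      using adjacent_ins_only[OF assms(3,4,1,2) assms(5)[symmetric] _ _ assms(7,6) ji] by blast
  next
    case 3
    then show ?thesis
      using adjacent_both_outs_only[OF assms(1-5) _ _ assms(6-8)]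
        adjacent_outs_only[OF assms(1-5) _ _ assms(6-8)] by blast
  next
    case 4
    then show ?thesis unfolding sym
      using adjacent_outs_only[OF assms(3,4,1,2) assms(5)[symmetric] _ _ assms(7,6) ji] by blast
  next
    case 5
    have ci: "d = 1 \<or> even (i + a)" if "a \<in> nbs w" for a
      using same_class[OF assms(1,2,6) that] .
    have cj: "d = 1 \<or> even (j + a)" if "a \<in> nbs w'" for a
      using same_class[OF assms(3,4,7) that] .
    show ?thesis
    proof (rule ccontr)
      assume na: "\<not> ?thesis"
      then have na': "\<not> adjacent A w' w" using sym by simp
      show False
      proof (cases "d = 1 \<or> even i")
        case True
        have "d = 1 \<or> even a" if "a \<in> nbs w" for a using ci[OF that] True by presburger
        moreover have "d = 1 \<or> odd a" if "a \<in> nbs w'" for a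
          using cj[OF that] True assms(8) by presburger
        ultimately have "detached w w'" using assms(2,4,5) na 5 unfolding detached_def by blast
        then show False using not_detached by blast
      next
        case False
        have "d = 1 \<or> odd a" if "a \<in> nbs w" for a using ci[OF that] False by presburger
        moreover have "d = 1 \<or> even a" if "a \<in> nbs w'" for a
          using cj[OF that] False assms(8) by presburger
        ultimately have "detached w' w"
          using assms(2,4,5) na' 5 unfolding detached_def by blast
        then show False using not_detached by blast
      qed
    qed
  qed
qed

section \<open>Conclusion\<close>

lemma path_structure:
  "semicomplete S (induced_arcs A S) \<or> semicomplete_bipartite S (induced_arcs A S)"
proof -
  have adj: "adjacent A (x i) (x j)"
    if ij: "i \<le> k + 2" "j \<le> k + 2" "d = 1 \<or> odd (i + j)" "i < j" for i j
  proof (cases "j = Suc i")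
    case True
    then show ?thesis using step[of i] ij by (simp add: adjacent_def)
  next
    case False
    have "E j i" by (rule back_arc) (use False ij in \<open>auto simp: add.commute\<close>)
    then show ?thesis by (simp add: adjacent_def)
  qed
  have adj': "adjacent (induced_arcs A S) (x i) (x j)"
    if ij: "i \<le> k + 2" "j \<le> k + 2" "d = 1 \<or> odd (i + j)" "i \<noteq> j" for i j
  proof -
    have "adjacent A (x i) (x j)"
    proof (cases "i < j")
      case True
      then show ?thesis using adj ij by blast
    next
      case False
      then have "adjacent A (x j) (x i)" using adj[of j i] ij by (simp add: add.commute)
      then show ?thesis by (simp add: adjacent_commute)
    qed
    then show ?thesis using ij by (auto simp: adjacent_def induced_arcs_def)
  qed
  from d show ?thesis
  proof
    assume "d = 1"
    then have "semicomplete S (induced_arcs A S)"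
      unfolding semicomplete_def using adj' by (metis atMost_iff imageE)
    then show ?thesis ..
  next
    assume d2: "d = 2"
    define X where "X = x ` {i. i \<le> k + 2 \<and> even i}"
    define Y where "Y = x ` {i. i \<le> k + 2 \<and> odd i}"
    have "x 0 \<in> X" "x 1 \<in> Y" unfolding X_def Y_def by (rule imageI; simp)+
    then have ne: "X \<noteq> {}" "Y \<noteq> {}" by auto
    have disj: "X \<inter> Y = {}" unfolding X_def Y_def using x_eq_iff by fastforce
    have un: "X \<union> Y = S" unfolding X_def Y_def by auto
    have noX: "(a, b) \<notin> induced_arcs A S" if "a \<in> X" "b \<in> X" for a b
      using that arc_mod d2 by (fastforce simp: X_def induced_arcs_def)
    have noY: "(a, b) \<notin> induced_arcs A S" if "a \<in> Y" "b \<in> Y" for a b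
      using that arc_mod d2 by (fastforce simp: Y_def induced_arcs_def)
    have XY: "adjacent (induced_arcs A S) a b" if ab: "a \<in> X" "b \<in> Y" for a b
    proof -
      obtain i j where "a = x i" "i \<le> k + 2" "even i" "b = x j" "j \<le> k + 2" "odd j"
        using ab by (auto simp: X_def Y_def)
      moreover from this have "i \<noteq> j" by auto
      ultimately show ?thesis using adj'[of i j] by simp
    qed
    have "semicomplete_bipartite S (induced_arcs A S)"
      unfolding semicomplete_bipartite_def
      by (rule exI[of _ X], rule exI[of _ Y], intro conjI ballI ne disj un)
        (rule noX noY XY; assumption)+
    then show ?thesis ..
  qed
qed

lemma complement_structure:
  "semicomplete (V - S) (induced_arcs A (V - S)) \<or>
   semicomplete_bipartite (V - S) (induced_arcs A (V - S)) \<or>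
   empty_digraph (V - S) (induced_arcs A (V - S))"
proof -
  from d show ?thesis
  proof
    assume d1: "d = 1"
    have "adjacent (induced_arcs A (V - S)) w w'" if w: "w \<in> V - S" "w' \<in> V - S" "w \<noteq> w'" for w w'
    proof -
      obtain i j where "i \<in> nbs w" "j \<in> nbs w'"
        using nbs_nonempty[of w] nbs_nonempty[of w'] w by blast
      then have "adjacent A w w'" using adjacent_opposite[of w w' i j] w d1 by blast
      then show ?thesis using w by (auto simp: adjacent_def induced_arcs_def)
    qed
    then show ?thesis unfolding semicomplete_def by blast
  next
    assume d2: "d = 2"
    define X where "X = {w \<in> V - S. \<exists>i\<in>nbs w. even i}"
    define Y where "Y = {w \<in> V - S. \<exists>i\<in>nbs w. odd i}"
    have XY: "X \<union> Y = V - S" unfolding X_def Y_def using nbs_nonempty by blast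
    have disj: "X \<inter> Y = {}"
    proof -
      have False if w: "w \<in> X" "w \<in> Y" for w
      proof -
        obtain i j where "w \<in> V" "w \<notin> S" "i \<in> nbs w" "even i" "j \<in> nbs w" "odd j"
          using w by (auto simp: X_def Y_def)
        then show False using same_class[of w i j] d2 by simp
      qed
      then show ?thesis by blast
    qed
    have noX: "(a, b) \<notin> A" if ab: "a \<in> X" "b \<in> X" for a b
    proof
      assume arc: "(a, b) \<in> A"
      obtain i j where "a \<notin> S" "b \<notin> S" "i \<in> nbs a" "even i" "j \<in> nbs b" "even j"
        using ab by (auto simp: X_def)
      then show False using cross[OF arc, of i j] d2 by simp
    qed
    have noY: "(a, b) \<notin> A" if ab: "a \<in> Y" "b \<in> Y" for a b
    proof
      assume arc: "(a, b) \<in> A"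
      obtain i j where "a \<notin> S" "b \<notin> S" "i \<in> nbs a" "odd i" "j \<in> nbs b" "odd j"
        using ab by (auto simp: Y_def)
      then show False using cross[OF arc, of i j] d2 by simp
    qed
    have adj: "adjacent (induced_arcs A (V - S)) a b" if ab: "a \<in> X" "b \<in> Y" for a b
    proof -
      obtain i j where ij: "a \<in> V" "a \<notin> S" "b \<in> V" "b \<notin> S" "i \<in> nbs a" "even i" "j \<in> nbs b" "odd j"
        using ab by (auto simp: X_def Y_def)
      have "a \<noteq> b" using ab disj by blast
      then have "adjacent A a b" using adjacent_opposite[OF ij(1-4) _ ij(5,7)] ij(6,8) by simp
      then show ?thesis using ij(1-4) by (auto simp: adjacent_def induced_arcs_def)
    qed
    show ?thesis
    proof (cases "X = {} \<or> Y = {}")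
      case True
      \<comment> \<open>All arcs outside \<open>P\<close> run between the two classes, so an empty
        class leaves no arcs.\<close>
      have "(a, b) \<notin> induced_arcs A (V - S)" for a b
        using True XY noX[of a b] noY[of a b] unfolding induced_arcs_def by blast
      then have "induced_arcs A (V - S) = {}" by auto
      then show ?thesis by (simp add: empty_digraph_def)
    next
      case False
      have "semicomplete_bipartite (V - S) (induced_arcs A (V - S))"
        unfolding semicomplete_bipartite_def
      proof (rule exI[of _ X], rule exI[of _ Y], intro conjI ballI)
        show "X \<noteq> {}" "Y \<noteq> {}" using False by auto
        show "X \<inter> Y = {}" by (rule disj)
        show "X \<union> Y = V - S" by (rule XY)
      qed (use noX noY adj in \<open>auto simp: induced_arcs_def\<close>)
      then show ?thesis by blast
    qed
  qed
qed

end

section \<open>Walks, distances and the instantiation of the locales\<close>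

lemma path_of_walk:
  assumes "A \<subseteq> V \<times> V" "a \<in> V" "(a, b) \<in> A ^^ n"
  shows "\<exists>p. is_xy_path V A a b p \<and> length p \<le> Suc n"
  using assms(2,3)
proof (induction n arbitrary: a)
  case 0
  then show ?case by (intro exI[of _ "[a]"]) (auto simp: is_xy_path_def is_path_def)
next
  case (Suc n)
  obtain c where c: "(a, c) \<in> A" "(c, b) \<in> A ^^ n" using Suc.prems(2) by (meson relpow_Suc_D2)
  obtain p where p: "is_xy_path V A c b p" "length p \<le> Suc n"
    using Suc.IH[OF _ c(2)] c(1) assms(1) by blast
  show ?case
  proof (cases "a \<in> set p")
    case True
    then obtain t where t: "t < length p" "p ! t = a" by (auto simp: in_set_conv_nth)
    \<comment> \<open>The walk returns to \<open>a\<close>, so the closed part before that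
      occurrence is cut off.\<close>
    have "is_xy_path V A a b (drop t p)"
      using p(1) t set_drop_subset[of t p]
      by (auto simp: is_xy_path_def is_path_def hd_drop_conv_nth)
    then show ?thesis using p(2) by (intro exI[of _ "drop t p"]) simp
  next
    case False
    have "((a # p) ! i, (a # p) ! Suc i) \<in> A" if "Suc i < length (a # p)" for i
      using that p(1) c(1) by (cases i) (auto simp: is_xy_path_def is_path_def hd_conv_nth)
    then have "is_xy_path V A a b (a # p)"
      using p(1) False Suc.prems(1) by (auto simp: is_xy_path_def is_path_def)
    then show ?thesis using p(2) by (intro exI[of _ "a # p"]) simp
  qed
qed

lemma dist_le_walk:
  assumes "A \<subseteq> V \<times> V" "a \<in> V" "(a, b) \<in> A ^^ n"
  shows "dist V A a b \<le> enat n"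
proof -
  obtain p where p: "is_xy_path V A a b p" "length p \<le> Suc n" using path_of_walk[OF assms] by blast
  have "dist V A a b \<le> enat (length p - 1)" unfolding dist_def by (rule INF_lower) (use p in simp)
  also have "\<dots> \<le> enat n" using p(2) by simp
  finally show ?thesis .
qed

lemma relpow_along_path:
  assumes "is_path V A p" "i \<le> j" "j < length p"
  shows "(p ! i, p ! j) \<in> A ^^ (j - i)"
  using assms(2,3)
proof (induction j rule: dec_induct)
  case (step j)
  have "(p ! j, p ! Suc j) \<in> A" using assms(1) step.prems by (simp add: is_path_def)
  then show ?case using step by (auto simp: Suc_diff_le)
qed simp

theorem theorem1p3:
  fixes V :: "'a set" and A :: "('a \<times> 'a) set" and k :: nat
    and u v :: 'a and P :: "'a list"
  assumes "digraph V A"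
    and "odd k" and "k \<ge> 5"
    and "strong V A"
    and "k_quasi_transitive k V A"
    and "diam V A \<ge> enat (k + 2)"
    and "u \<in> V" and "v \<in> V"
    and "dist V A u v = enat (k + 2)"
    and "shortest_path V A u v P"
  shows "(semicomplete (set P) (induced_arcs A (set P)) \<or>
          semicomplete_bipartite (set P) (induced_arcs A (set P))) \<and>
         (semicomplete (V - set P) (induced_arcs A (V - set P)) \<or>
          semicomplete_bipartite (V - set P) (induced_arcs A (V - set P)) \<or>
          empty_digraph (V - set P) (induced_arcs A (V - set P)))"
proof -
  have AV: "A \<subseteq> V \<times> V" and loopfree: "\<And>a. (a, a) \<notin> A" using assms(1) by (auto simp: digraph_def)
  have P: "is_path V A P" "hd P = u" "last P = v" "length P = k + 3"
    using assms(9,10) by (auto simp: shortest_path_def is_xy_path_def)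
  have ends: "P ! 0 = u" "P ! (k + 2) = v"
    using P by (auto simp: is_path_def hd_conv_nth last_conv_nth)
  have setP: "set P = (!) P ` {..k+2}"
    using P(4) by (auto simp: set_conv_nth)
  have Ppos: "distinct P" "set P \<subseteq> V" using P(1) by (auto simp: is_path_def)
  interpret kqt_geodesic A k "(!) P"
  proof
    fix p assume p: "distinct p" "arcwise A p" "length p = k + 1"
    have arc: "(p ! i, p ! Suc i) \<in> A" if "Suc i < length p" for i
      using successively_nth[OF p(2) that] .
    \<comment> \<open>Membership in \<open>V\<close> comes from the arcs: each vertex of a list with
      at least two vertices is an end of one.\<close>
    have "p ! i \<in> V" if "i < length p" for i
    proof (cases i)
      case 0
      then show ?thesis using arc[of 0] AV p(3) assms(3) by auto
    next
      case (Suc j)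
      then show ?thesis using arc[of j] AV that by auto
    qed
    then have "set p \<subseteq> V" by (auto simp: in_set_conv_nth)
    then have "is_path V A p" using p arc by (auto simp: is_path_def)
    then show "adjacent A (hd p) (last p)" using assms(5) p(3) by (simp add: k_quasi_transitive_def)
  next
    show "inj_on ((!) P) {..k+2}"
      using Ppos(1) P(4) by (auto simp: inj_on_def nth_eq_iff_index_eq)
  next
    fix i assume "i < k + 2"
    then show "(P ! i, P ! Suc i) \<in> A" using P by (auto simp: is_path_def)
  next
    fix i j l assume ij: "i \<le> k + 2" "j \<le> k + 2" "(P ! i, P ! j) \<in> A ^^ l"
    \<comment> \<open>Replacing the part of \<open>P\<close> between the two vertices by the given
      walk yields a walk from \<open>u\<close> to \<open>v\<close>, whose length is at least
      \<open>k + 2\<close>.\<close>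
    have "(u, P ! i) \<in> A ^^ i" using relpow_along_path[OF P(1), of 0 i] ij(1) P(4) ends by simp
    then have "(u, P ! j) \<in> A ^^ (i + l)" using ij(3) by (rule relpow_trans)
    moreover have "(P ! j, v) \<in> A ^^ (k + 2 - j)"
      using relpow_along_path[OF P(1) ij(2)] P(4) ends by simp
    ultimately have "(u, v) \<in> A ^^ (i + l + (k + 2 - j))" by (rule relpow_trans)
    then have "enat (k + 2) \<le> enat (i + l + (k + 2 - j))"
      using dist_le_walk[OF AV assms(7)] assms(9) by metis
    then show "j \<le> i + l" using ij(2) by simp
  qed (use assms(2,3) in auto)
  obtain d :: nat where d: "d = 1 \<or> d = 2"
    "\<forall>i j. j + 2 \<le> i \<longrightarrow> i \<le> k + 2 \<longrightarrow> d = 1 \<or> odd (i + j) \<longrightarrow> (P ! i, P ! j) \<in> A"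
    "\<forall>i j. i \<le> k + 2 \<longrightarrow> j \<le> k + 2 \<longrightarrow> (P ! i, P ! j) \<in> A \<longrightarrow> d = 1 \<or> odd (i + j)"
    using back_dichotomy[OF loopfree] by (elim exE conjE) (rule that)
  interpret kqt_geodesic_mod A k "(!) P" d V
  proof
    fix a b assume "a \<in> V" "b \<in> V"
    then obtain p where p: "is_xy_path V A a b p" using assms(4) by (auto simp: strong_def)
    then have "(p ! 0, p ! (length p - 1)) \<in> A ^^ (length p - 1 - 0)"
      by (intro relpow_along_path) (auto simp: is_xy_path_def is_path_def)
    then have "(a, b) \<in> A ^^ (length p - 1)"
      using p by (auto simp: is_xy_path_def is_path_def hd_conv_nth last_conv_nth)
    then show "(a, b) \<in> A\<^sup>*" by (rule relpow_imp_rtrancl)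
  next
    show "(!) P ` {..k+2} \<subseteq> V" using Ppos(2) setP by simp
  qed (rule d(1) d(2)[rule_format] d(3)[rule_format] AV loopfree; assumption)+
  show ?thesis using path_structure complement_structure unfolding setP by blast
qed

end
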